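(* Let $n\ge1$, $r>1$ and $\sigma_0>0$. For each $s\in\mathbb{Z}$ define the dual synthesis filter $\widetilde\Phi_s$ through its Fourier transform by $$\widehat{\widetilde\Phi_s}(\xi)=\frac{\overline{\widehat{\Phi_s}(\xi)}}{F(\xi)},\qquad \xi\ne0,\qquad\text{where } F(\xi)=\sum_{s\in\mathbb{Z}}|\widehat{\Phi_s}(\xi)|^2 .$$ Then, for every $u\in L^2(\mathbb{R}^n)$, $$u=\sum_{s\in\mathbb{Z}}(u*\Phi_s)*\widetilde\Phi_s\quad\text{almost everywhere},$$ where the series converges in $L^2(\mathbb{R}^n)$.
   Context: The Fourier transform is $\hat u(\xi)=\int_{\mathbb{R}^n}u(x)e^{-ix\cdot\xi}\,dx$. For $\sigma>0$ let $\gamma_\sigma(x)=(2\pi\sigma^2)^{-n/2}\exp(-|x|^2/(2\sigma^2))$, so $\hat\gamma_\sigma(\xi)=e^{-\sigma^2|\xi|^2/2}$. For $s\in\mathbb{Z}$ put $\sigma_s=r^s\sigma_0$ and $\Phi_s=\gamma_{\sigma_s}-\gamma_{\sigma_{s-1}}$ (difference-of-Gaussians filters). The function $F$ satisfies $0<c\le F(\xi)\le C<\infty$ for all $\xi\neq0$ and some constants $c,C$. Convolution of an $L^2$ function $v$ with $\widetilde\Phi_s$ is understood as the Fourier multiplier $v\mapsto \mathcal F^{-1}\big(\widehat{\widetilde\Phi_s}\,\hat v\big)$ on $L^2(\mathbb{R}^n)$; convergence of the sum over $s\in\mathbb{Z}$ means convergence of the symmetric partial sums over $|s|\le N$ as $N\to\infty$.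 *)

theory Defs
  imports "HOL-Analysis.Analysis"
begin

definition L2 :: "('a::euclidean_space \<Rightarrow> complex) set" where
  "L2 = {f. f \<in> borel_measurable lebesgue \<and> integrable lebesgue (\<lambda>x. (cmod (f x))\<^sup>2)}"

definition L2_norm :: "('a::euclidean_space \<Rightarrow> complex) \<Rightarrow> real" where
  "L2_norm f = sqrt (LINT x|lebesgue. (cmod (f x))\<^sup>2)"

text \<open>Elements of \<open>L2\<close> are functions, not classes modulo null sets, so the limit below is unique only
  almost everywhere. Membership in \<open>L2\<close> is demanded explicitly because the integral in \<open>L2_norm\<close>
  is \<open>0\<close> for non-integrable integrands.\<close>

definition L2_tendsto ::
  "(nat \<Rightarrow> 'a::euclidean_space \<Rightarrow> complex) \<Rightarrow> ('a \<Rightarrow> complex) \<Rightarrow> bool" where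
  "L2_tendsto f g \<longleftrightarrow>
     (\<forall>k. f k \<in> L2) \<and> g \<in> L2 \<and> (\<lambda>k. L2_norm (\<lambda>x. f k x - g x)) \<longlonglongrightarrow> 0"

definition fourier :: "('a::euclidean_space \<Rightarrow> complex) \<Rightarrow> 'a \<Rightarrow> complex" where
  "fourier f \<xi> = (LINT x|lebesgue. f x * exp (- (\<i> * complex_of_real (x \<bullet> \<xi>))))"

text \<open>The Fourier transform on \<open>L2\<close> is the continuous extension of the integral transform from
  integrable functions in \<open>L2\<close>. It is a bijection of \<open>L2\<close> modulo null sets; \<open>fourier_L2\<close> and
  \<open>inv_fourier_L2\<close> choose representatives of the transform and of its inverse.\<close>

definition has_fourier_L2 ::
  "('a::euclidean_space \<Rightarrow> complex) \<Rightarrow> ('a \<Rightarrow> complex) \<Rightarrow> bool" where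
  "has_fourier_L2 u v \<longleftrightarrow>
     (\<exists>f. (\<forall>k. integrable lebesgue (f k)) \<and> L2_tendsto f u \<and> L2_tendsto (\<lambda>k. fourier (f k)) v)"

definition fourier_L2 :: "('a::euclidean_space \<Rightarrow> complex) \<Rightarrow> 'a \<Rightarrow> complex" where
  "fourier_L2 u = (SOME v. has_fourier_L2 u v)"

definition inv_fourier_L2 :: "('a::euclidean_space \<Rightarrow> complex) \<Rightarrow> 'a \<Rightarrow> complex" where
  "inv_fourier_L2 v = (SOME u. has_fourier_L2 u v)"

definition fourier_multiplier ::
  "('a::euclidean_space \<Rightarrow> complex) \<Rightarrow> ('a \<Rightarrow> complex) \<Rightarrow> 'a \<Rightarrow> complex" where
  "fourier_multiplier m v = inv_fourier_L2 (\<lambda>\<xi>. m \<xi> * fourier_L2 v \<xi>)"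

definition conv ::
  "('a::euclidean_space \<Rightarrow> complex) \<Rightarrow> ('a \<Rightarrow> complex) \<Rightarrow> 'a \<Rightarrow> complex" where
  "conv f g x = (LINT y|lebesgue. f y * g (x - y))"

definition gaussian :: "real \<Rightarrow> 'a::euclidean_space \<Rightarrow> real" where
  "gaussian \<sigma> x =
     (2 * pi * \<sigma>\<^sup>2) powr (- real DIM('a) / 2) * exp (- (norm x)\<^sup>2 / (2 * \<sigma>\<^sup>2))"

definition dog_scale :: "real \<Rightarrow> real \<Rightarrow> int \<Rightarrow> real" where
  "dog_scale r \<sigma>0 s = r powi s * \<sigma>0"

definition dog_filter :: "real \<Rightarrow> real \<Rightarrow> int \<Rightarrow> 'a::euclidean_space \<Rightarrow> complex" where
  "dog_filter r \<sigma>0 s x =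
     complex_of_real (gaussian (dog_scale r \<sigma>0 s) x - gaussian (dog_scale r \<sigma>0 (s - 1)) x)"

definition filter_energy :: "real \<Rightarrow> real \<Rightarrow> 'a::euclidean_space \<Rightarrow> real" where
  "filter_energy r \<sigma>0 \<xi> = (\<Sum>\<^sub>\<infinity>s\<in>(UNIV::int set). (cmod (fourier (dog_filter r \<sigma>0 s) \<xi>))\<^sup>2)"

text \<open>The Fourier transform of the dual synthesis filter. It is meant for \<open>\<xi> \<noteq> 0\<close>; the value at \<open>0\<close>
  is \<open>0 / 0 = 0\<close> and does not matter.\<close>

definition dual_symbol :: "real \<Rightarrow> real \<Rightarrow> int \<Rightarrow> 'a::euclidean_space \<Rightarrow> complex" where
  "dual_symbol r \<sigma>0 s \<xi> =
     cnj (fourier (dog_filter r \<sigma>0 s) \<xi>) / complex_of_real (filter_energy r \<sigma>0 \<xi>)"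

text \<open>Convolution with the dual filter, which is given only through its symbol.\<close>

definition conv_dual ::
  "real \<Rightarrow> real \<Rightarrow> int \<Rightarrow> ('a::euclidean_space \<Rightarrow> complex) \<Rightarrow> 'a \<Rightarrow> complex" where
  "conv_dual r \<sigma>0 s = fourier_multiplier (dual_symbol r \<sigma>0 s)"

end

theory Submission
  imports Defs "HOL-Probability.Characteristic_Functions"
begin

text \<open>On the Fourier side the partial sums of the series multiply the transform of \<open>u\<close> by the partial
  sums of \<open>|\<Phi>\<^sub>s^|\<^sup>2 / F\<close>, which are at most \<open>1\<close> and tend to \<open>1\<close> off the origin, so dominated
  convergence and the boundedness of the inverse transform give the claim.

  Boundedness of the transform on \<open>L2\<close> and the inversion formula come from one identity: for integrable
  \<open>f\<close>, the transform of the conjugate of \<open>f^\<close> times \<open>exp (- \<epsilon>\<^sup>2 |\<xi>|\<^sup>2 / 2)\<close> is \<open>(2 \<pi>)\<^sup>n\<close> times the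
  convolution of the conjugate of \<open>f\<close> with \<open>\<gamma>\<^sub>\<epsilon>\<close>. Paired with \<open>f^\<close> it bounds \<open>\<parallel>f^\<parallel>\<close> as \<open>\<epsilon> \<rightarrow> 0\<close>;
  for compactly supported continuous \<open>f\<close>, which are dense, the limit \<open>\<epsilon> \<rightarrow> 0\<close> is Fourier inversion.
  Bounds with non-optimal constants suffice, so Plancherel's identity itself is not needed.\<close>

subsection \<open>Square-integrable functions\<close>

text \<open>Norms enter only through their squares \<open>L2_sq\<close>. The triangle inequality
  then becomes \<open>(a + b)^2 \<le> 2 * a^2 + 2 * b^2\<close>, and each use costs a factor 2; this
  is the origin of the 4 in the bounds for the transform and its inverse. Such factors are harmless,
  since the bounds serve to show that quantities tend to 0 or vanish. The obstacle is that
  \<open>fourier_L2\<close> and \<open>inv_fourier_L2\<close> are arbitrary choices, determined only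
  almost everywhere. The work is therefore done on the relation \<open>has_fourier_L2\<close>, which
  is linear, closed under limits in both arguments, defined on all of \<open>L2\<close> and onto;
  the chosen representatives occur only when \<open>conv_dual\<close> is analysed. In contrast,
  \<open>conv\<close> is a genuine pointwise integral, so its agreement with a Fourier multiplier
  needs a proof. Both there and in the inversion formula an L2 limit has to be matched with a
  pointwise one, which is done by Fatou's lemma.\<close>

definition L2_sq :: "('a::euclidean_space \<Rightarrow> complex) \<Rightarrow> real" where
  "L2_sq f = (LINT x|lebesgue. (cmod (f x))\<^sup>2)"

lemma L2_sq_nonneg [simp]: "0 \<le> L2_sq f"
  by (simp add: L2_sq_def)

lemma L2_D:
  assumes "f \<in> L2"
  shows "f \<in> borel_measurable lebesgue" "integrable lebesgue (\<lambda>x. (cmod (f x))\<^sup>2)"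
  using assms by (auto simp: L2_def)

lemma L2_bounded:
  assumes "g \<in> L2" "f \<in> borel_measurable lebesgue" "AE x in lebesgue. cmod (f x) \<le> B * cmod (g x)"
  shows "f \<in> L2"
proof -
  have "integrable lebesgue (\<lambda>x. (cmod (f x))\<^sup>2)"
  proof (rule Bochner_Integration.integrable_bound)
    show "integrable lebesgue (\<lambda>x. B\<^sup>2 * (cmod (g x))\<^sup>2)"
      using L2_D[OF assms(1)] by simp
    show "(\<lambda>x. (cmod (f x))\<^sup>2) \<in> borel_measurable lebesgue"
      using assms(2) by measurable
    show "AE x in lebesgue. norm ((cmod (f x))\<^sup>2) \<le> norm (B\<^sup>2 * (cmod (g x))\<^sup>2)"
      using assms(3)
    proof eventually_elim
      case (elim x)
      then have "(cmod (f x))\<^sup>2 \<le> (B * cmod (g x))\<^sup>2"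
        by (intro power_mono) auto
      then show ?case by (simp add: power_mult_distrib)
    qed
  qed
  then show ?thesis using assms(2) by (simp add: L2_def)
qed

lemma L2_AE_cong:
  assumes "f \<in> L2" "AE x in lebesgue. f x = g x"
  shows "g \<in> L2" "L2_sq g = L2_sq f"
proof -
  have g: "g \<in> borel_measurable lebesgue"
    using borel_measurable_AE[OF L2_D(1)[OF assms(1)] assms(2)] .
  show "g \<in> L2"
    by (rule L2_bounded[OF assms(1) g, of 1]) (use assms(2) in auto)
  show "L2_sq g = L2_sq f"
    unfolding L2_sq_def
    by (rule integral_cong_AE) (use g L2_D[OF assms(1)] assms(2) in auto)
qed

lemma cmod_add_sq_le: "(cmod (a + b))\<^sup>2 \<le> 2 * (cmod a)\<^sup>2 + 2 * (cmod b)\<^sup>2"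
proof -
  have "(cmod (a + b))\<^sup>2 \<le> (cmod a + cmod b)\<^sup>2"
    by (intro power_mono norm_triangle_ineq) auto
  also have "\<dots> \<le> 2 * (cmod a)\<^sup>2 + 2 * (cmod b)\<^sup>2"
    using zero_le_power2[of "cmod a - cmod b"] by (simp add: power2_eq_square algebra_simps)
  finally show ?thesis .
qed

lemma
  assumes "f \<in> L2" "g \<in> L2"
  shows L2_add: "(\<lambda>x. f x + g x) \<in> L2"
    and L2_sq_add_le: "L2_sq (\<lambda>x. f x + g x) \<le> 2 * L2_sq f + 2 * L2_sq g"
proof -
  note [measurable] = L2_D(1)[OF assms(1)] L2_D(1)[OF assms(2)]
  note [simp] = L2_D(2)[OF assms(1)] L2_D(2)[OF assms(2)]
  have i: "integrable lebesgue (\<lambda>x. 2 * (cmod (f x))\<^sup>2 + 2 * (cmod (g x))\<^sup>2)"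
    by simp
  have j: "integrable lebesgue (\<lambda>x. (cmod (f x + g x))\<^sup>2)"
    by (rule Bochner_Integration.integrable_bound[OF i]) (auto simp: cmod_add_sq_le)
  then show "(\<lambda>x. f x + g x) \<in> L2"
    by (simp add: L2_def)
  have "L2_sq (\<lambda>x. f x + g x) \<le> (LINT x|lebesgue. 2 * (cmod (f x))\<^sup>2 + 2 * (cmod (g x))\<^sup>2)"
    unfolding L2_sq_def by (rule integral_mono[OF j i]) (rule cmod_add_sq_le)
  then show "L2_sq (\<lambda>x. f x + g x) \<le> 2 * L2_sq f + 2 * L2_sq g"
    by (simp add: L2_sq_def)
qed

lemma L2_cmult:
  assumes "f \<in> L2" shows "(\<lambda>x. a * f x) \<in> L2"
  by (rule L2_bounded[OF assms, of _ "cmod a"])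
    (use L2_D[OF assms] in \<open>auto simp: norm_mult\<close>)

lemma L2_sq_cmult: "L2_sq (\<lambda>x. a * f x) = (cmod a)\<^sup>2 * L2_sq f"
  by (simp add: L2_sq_def norm_mult power_mult_distrib)

lemma L2_cnj:
  assumes "f \<in> L2" shows "(\<lambda>x. cnj (f x)) \<in> L2"
proof -
  have "(\<lambda>x. cnj (f x)) \<in> borel_measurable lebesgue"
    using L2_D(1)[OF assms] by (intro borel_measurable_continuous_on[of cnj]) (auto intro!: continuous_intros)
  then show ?thesis
    by (intro L2_bounded[OF assms, of _ 1]) auto
qed

lemma L2_sq_cnj [simp]: "L2_sq (\<lambda>x. cnj (f x)) = L2_sq f"
  by (simp add: L2_sq_def)

lemma L2_sq_minus_commute: "L2_sq (\<lambda>x. f x - g x) = L2_sq (\<lambda>x. g x - f x)"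
  by (simp add: L2_sq_def norm_minus_commute)

lemma L2_diff:
  assumes "f \<in> L2" "g \<in> L2" shows "(\<lambda>x. f x - g x) \<in> L2"
  using L2_add[OF assms(1) L2_cmult[OF assms(2), of "-1"]] by simp

lemma L2_zero: "(\<lambda>x. 0) \<in> L2"
  by (simp add: L2_def)

lemma L2_sq_triangle:
  assumes "f \<in> L2" "g \<in> L2" "h \<in> L2"
  shows "L2_sq (\<lambda>x. f x - h x) \<le> 2 * L2_sq (\<lambda>x. f x - g x) + 2 * L2_sq (\<lambda>x. g x - h x)"
  using L2_sq_add_le[OF L2_diff[OF assms(1,2)] L2_diff[OF assms(2,3)]] by simp

text \<open>The Bochner integral is 0 for a non-integrable integrand, so a bound on
  \<open>L2_sq\<close> alone says nothing about membership in \<open>L2\<close>. The nonnegative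
  integral carries both facts at once and is the form in which Fatou's lemma applies.\<close>

lemma L2_sq_le_iff_nn_integral:
  assumes "f \<in> borel_measurable lebesgue" "0 \<le> B"
  shows "f \<in> L2 \<and> L2_sq f \<le> B \<longleftrightarrow> (\<integral>\<^sup>+x. ennreal ((cmod (f x))\<^sup>2) \<partial>lebesgue) \<le> ennreal B"
proof
  assume "f \<in> L2 \<and> L2_sq f \<le> B"
  then show "(\<integral>\<^sup>+x. ennreal ((cmod (f x))\<^sup>2) \<partial>lebesgue) \<le> ennreal B"
    by (subst nn_integral_eq_integral) (auto simp: L2_D L2_sq_def ennreal_leI)
next
  assume *: "(\<integral>\<^sup>+x. ennreal ((cmod (f x))\<^sup>2) \<partial>lebesgue) \<le> ennreal B"
  have i: "integrable lebesgue (\<lambda>x. (cmod (f x))\<^sup>2)"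
    by (rule integrableI_bounded) (use assms le_less_trans[OF * ennreal_less_top] in auto)
  then have "ennreal (L2_sq f) \<le> ennreal B"
    using * unfolding L2_sq_def by (subst (asm) nn_integral_eq_integral) auto
  then show "f \<in> L2 \<and> L2_sq f \<le> B"
    using i assms by (simp add: L2_def)
qed

text \<open>The total function \<open>lim\<close> is measurable without any convergence, and
  completeness of \<open>lebesgue\<close> allows a change on a null set.\<close>

lemma borel_measurable_lebesgue_AE_limit:
  fixes f :: "nat \<Rightarrow> 'a::euclidean_space \<Rightarrow> complex"
  assumes "\<And>k. f k \<in> borel_measurable lebesgue" "AE x in lebesgue. (\<lambda>k. f k x) \<longlonglongrightarrow> g x"
  shows "g \<in> borel_measurable lebesgue"
proof (rule borel_measurable_AE)
  show "(\<lambda>x. lim (\<lambda>k. f k x)) \<in> borel_measurable lebesgue"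
    using assms(1) by (rule borel_measurable_lim_metric)
  show "AE x in lebesgue. lim (\<lambda>k. f k x) = g x"
    using assms(2) by eventually_elim (rule limI)
qed

lemma L2_Fatou:
  assumes f: "\<And>k. f k \<in> L2" and B: "\<And>k. L2_sq (f k) \<le> B"
    and lim: "AE x in lebesgue. (\<lambda>k. f k x) \<longlonglongrightarrow> g x"
  shows "g \<in> L2 \<and> L2_sq g \<le> B"
proof -
  have g: "g \<in> borel_measurable lebesgue"
    using borel_measurable_lebesgue_AE_limit[OF L2_D(1)[OF f] lim] .
  note [measurable] = g L2_D(1)[OF f]
  have B0: "0 \<le> B" using B[of 0] L2_sq_nonneg[of "f 0"] by linarith
  have "(\<integral>\<^sup>+x. ennreal ((cmod (g x))\<^sup>2) \<partial>lebesgue) =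
        (\<integral>\<^sup>+x. liminf (\<lambda>k. ennreal ((cmod (f k x))\<^sup>2)) \<partial>lebesgue)"
  proof (rule nn_integral_cong_AE)
    show "AE x in lebesgue. ennreal ((cmod (g x))\<^sup>2) = liminf (\<lambda>k. ennreal ((cmod (f k x))\<^sup>2))"
      using lim
    proof eventually_elim
      case (elim x)
      have "(\<lambda>k. ennreal ((cmod (f k x))\<^sup>2)) \<longlonglongrightarrow> ennreal ((cmod (g x))\<^sup>2)"
        using elim by (intro tendsto_intros)
      then show ?case by (intro lim_imp_Liminf[symmetric]) auto
    qed
  qed
  also have "\<dots> \<le> liminf (\<lambda>k. \<integral>\<^sup>+x. ennreal ((cmod (f k x))\<^sup>2) \<partial>lebesgue)"
    by (rule nn_integral_liminf) measurable
  also have "\<dots> \<le> liminf (\<lambda>k::nat. ennreal B)"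
    by (rule Liminf_mono) (use f B B0 L2_sq_le_iff_nn_integral[OF L2_D(1)[OF f]] in auto)
  also have "\<dots> = ennreal B" by (simp add: Liminf_const)
  finally show ?thesis
    using L2_sq_le_iff_nn_integral[OF g B0] by simp
qed

section \<open>Convergence in L2, expressed by squared distances\<close>

lemma L2_tendsto_iff:
  "L2_tendsto f g \<longleftrightarrow> (\<forall>k. f k \<in> L2) \<and> g \<in> L2 \<and> (\<lambda>k. L2_sq (\<lambda>x. f k x - g x)) \<longlonglongrightarrow> 0"
proof -
  have "(\<lambda>k. L2_norm (\<lambda>x. f k x - g x)) \<longlonglongrightarrow> 0 \<longleftrightarrow> (\<lambda>k. L2_sq (\<lambda>x. f k x - g x)) \<longlonglongrightarrow> 0"
  proof
    assume "(\<lambda>k. L2_norm (\<lambda>x. f k x - g x)) \<longlonglongrightarrow> 0"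
    then have "(\<lambda>k. (L2_norm (\<lambda>x. f k x - g x))\<^sup>2) \<longlonglongrightarrow> 0\<^sup>2" by (intro tendsto_intros)
    then show "(\<lambda>k. L2_sq (\<lambda>x. f k x - g x)) \<longlonglongrightarrow> 0"
      by (simp add: L2_norm_def L2_sq_def)
  next
    assume "(\<lambda>k. L2_sq (\<lambda>x. f k x - g x)) \<longlonglongrightarrow> 0"
    then have "(\<lambda>k. sqrt (L2_sq (\<lambda>x. f k x - g x))) \<longlonglongrightarrow> sqrt 0" by (intro tendsto_intros)
    then show "(\<lambda>k. L2_norm (\<lambda>x. f k x - g x)) \<longlonglongrightarrow> 0"
      by (simp add: L2_norm_def L2_sq_def)
  qed
  then show ?thesis by (simp add: L2_tendsto_def)
qed

lemma L2_tendstoI_le: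
  assumes "\<And>k. f k \<in> L2" "g \<in> L2" "\<And>k. L2_sq (\<lambda>x. f k x - g x) \<le> d k" "d \<longlonglongrightarrow> 0"
  shows "L2_tendsto f g"
  unfolding L2_tendsto_iff
  using assms by (auto intro!: tendsto_sandwich[OF _ _ tendsto_const assms(4)])

lemma L2_tendsto_AE_cong:
  assumes "L2_tendsto f g" "AE x in lebesgue. g x = h x"
  shows "L2_tendsto f h"
proof -
  have "h \<in> L2" using assms L2_AE_cong by (auto simp: L2_tendsto_iff)
  moreover have "L2_sq (\<lambda>x. f k x - h x) = L2_sq (\<lambda>x. f k x - g x)" for k
    by (rule L2_AE_cong(2)) (use assms in \<open>auto simp: L2_tendsto_iff intro!: L2_diff\<close>)
  ultimately show ?thesis using assms(1) by (simp add: L2_tendsto_iff)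
qed

lemma L2_tendsto_add:
  assumes "L2_tendsto f g" "L2_tendsto f' g'"
  shows "L2_tendsto (\<lambda>k x. f k x + f' k x) (\<lambda>x. g x + g' x)"
proof (rule L2_tendstoI_le)
  note a = assms[unfolded L2_tendsto_iff]
  show "(\<lambda>k. 2 * L2_sq (\<lambda>x. f k x - g x) + 2 * L2_sq (\<lambda>x. f' k x - g' x)) \<longlonglongrightarrow> 0"
    using a by (auto intro!: tendsto_eq_intros)
  show "L2_sq (\<lambda>x. f k x + f' k x - (g x + g' x)) \<le> 2 * L2_sq (\<lambda>x. f k x - g x) + 2 * L2_sq (\<lambda>x. f' k x - g' x)" for k
    using L2_sq_add_le[of "\<lambda>x. f k x - g x" "\<lambda>x. f' k x - g' x"] a
    by (simp add: L2_diff algebra_simps)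
qed (use assms in \<open>auto simp: L2_tendsto_iff intro: L2_add\<close>)

lemma L2_tendsto_bounded_mult:
  assumes "L2_tendsto f g" "m \<in> borel_measurable lebesgue" "\<And>x. cmod (m x) \<le> B"
  shows "L2_tendsto (\<lambda>k x. m x * f k x) (\<lambda>x. m x * g x)"
proof (rule L2_tendstoI_le)
  note a = assms(1)[unfolded L2_tendsto_iff]
  have mL2: "(\<lambda>x. m x * h x) \<in> L2" if "h \<in> L2" for h
    by (rule L2_bounded[OF that, of _ B])
      (use assms L2_D[OF that] in \<open>auto simp: norm_mult intro!: mult_right_mono\<close>)
  show "(\<lambda>x. m x * f k x) \<in> L2" "(\<lambda>x. m x * g x) \<in> L2" for k
    using a mL2 by auto
  show "(\<lambda>k. B\<^sup>2 * L2_sq (\<lambda>x. f k x - g x)) \<longlonglongrightarrow> 0"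
    using a by (auto intro!: tendsto_eq_intros)
  show "L2_sq (\<lambda>x. m x * f k x - m x * g x) \<le> B\<^sup>2 * L2_sq (\<lambda>x. f k x - g x)" for k
    unfolding L2_sq_def integral_mult_right_zero[symmetric]
  proof (rule integral_mono)
    have d: "(\<lambda>x. f k x - g x) \<in> L2" using a by (auto intro: L2_diff)
    show "integrable lebesgue (\<lambda>x. (cmod (m x * f k x - m x * g x))\<^sup>2)"
      using L2_D(2)[OF mL2[OF d]] by (simp add: right_diff_distrib)
    show "integrable lebesgue (\<lambda>x. B\<^sup>2 * (cmod (f k x - g x))\<^sup>2)"
      using L2_D(2)[OF d] by simp
    show "(cmod (m x * f k x - m x * g x))\<^sup>2 \<le> B\<^sup>2 * (cmod (f k x - g x))\<^sup>2" for x
    proof -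
      have "cmod (m x * f k x - m x * g x) \<le> B * cmod (f k x - g x)"
        unfolding right_diff_distrib[symmetric] norm_mult
        by (intro mult_right_mono assms) auto
      then have "(cmod (m x * f k x - m x * g x))\<^sup>2 \<le> (B * cmod (f k x - g x))\<^sup>2"
        by (intro power_mono) auto
      then show ?thesis by (simp add: power_mult_distrib)
    qed
  qed
qed

lemma L2_tendsto_cmult:
  assumes "L2_tendsto f g"
  shows "L2_tendsto (\<lambda>k x. a * f k x) (\<lambda>x. a * g x)"
  by (rule L2_tendsto_bounded_mult[OF assms, of _ "cmod a"]) auto

lemma L2_tendsto_cnj:
  assumes "L2_tendsto f g"
  shows "L2_tendsto (\<lambda>k x. cnj (f k x)) (\<lambda>x. cnj (g x))"
  using assms L2_sq_cnj[of "\<lambda>x. f _ x - g x"]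
  by (auto simp: L2_tendsto_iff intro: L2_cnj)

lemma L2_sq_le_0_imp_AE_zero:
  assumes "f \<in> L2" "L2_sq f \<le> 0"
  shows "AE x in lebesgue. f x = 0"
proof -
  have "L2_sq f = 0" using assms(2) L2_sq_nonneg[of f] by linarith
  then have "AE x in lebesgue. (cmod (f x))\<^sup>2 = 0"
    unfolding L2_sq_def using integral_nonneg_eq_0_iff_AE[OF L2_D(2)[OF assms(1)]] by auto
  then show ?thesis by simp
qed

lemma L2_tendstoD:
  assumes "L2_tendsto f g" "e > 0"
  obtains K where "\<And>k. k \<ge> K \<Longrightarrow> L2_sq (\<lambda>x. f k x - g x) < e"
proof -
  have "\<forall>\<^sub>F k in sequentially. L2_sq (\<lambda>x. f k x - g x) < e"
    using assms by (intro order_tendstoD(2)[of _ 0]) (auto simp: L2_tendsto_iff)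
  then show ?thesis using that by (auto simp: eventually_sequentially)
qed

section \<open>Cauchy sequences, completeness and dominated convergence in L2\<close>

definition L2_Cauchy :: "(nat \<Rightarrow> 'a::euclidean_space \<Rightarrow> complex) \<Rightarrow> bool" where
  "L2_Cauchy f \<longleftrightarrow> (\<forall>k. f k \<in> L2) \<and>
     (\<forall>e>0. \<exists>K. \<forall>m\<ge>K. \<forall>n\<ge>K. L2_sq (\<lambda>x. f m x - f n x) < e)"

text \<open>Applied to the transform and to its inverse, both of which are linear with a bound on
  \<open>L2_sq\<close>.\<close>

lemma L2_Cauchy_scaled:
  assumes "L2_Cauchy f" "\<And>k. g k \<in> L2" "K > 0"
    and le: "\<And>m n. L2_sq (\<lambda>x. g m x - g n x) \<le> K * L2_sq (\<lambda>x. f m x - f n x)"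
  shows "L2_Cauchy g"
  unfolding L2_Cauchy_def
proof (intro conjI allI impI assms(2))
  fix e :: real assume "e > 0"
  then obtain N where N: "\<And>m n. m \<ge> N \<Longrightarrow> n \<ge> N \<Longrightarrow> L2_sq (\<lambda>x. f m x - f n x) < e / K"
    using assms(1,3) unfolding L2_Cauchy_def by (meson divide_pos_pos)
  have "L2_sq (\<lambda>x. g m x - g n x) < e" if "m \<ge> N" "n \<ge> N" for m n
    using le[of m n] N[OF that] \<open>K > 0\<close> by (simp add: less_divide_eq mult.commute)
  then show "\<exists>K. \<forall>m\<ge>K. \<forall>n\<ge>K. L2_sq (\<lambda>x. g m x - g n x) < e" by blast
qed

lemma L2_tendsto_imp_Cauchy:
  assumes "L2_tendsto f g" shows "L2_Cauchy f"
  unfolding L2_Cauchy_def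
proof (intro conjI allI impI)
  note a = assms[unfolded L2_tendsto_iff]
  show "f k \<in> L2" for k using a by auto
  fix e :: real assume "e > 0"
  then obtain K where K: "\<And>k. k \<ge> K \<Longrightarrow> L2_sq (\<lambda>x. f k x - g x) < e / 4"
    using L2_tendstoD[OF assms, of "e / 4"] by auto
  show "\<exists>K. \<forall>m\<ge>K. \<forall>n\<ge>K. L2_sq (\<lambda>x. f m x - f n x) < e"
  proof (intro exI allI impI)
    fix m n assume "K \<le> m" "K \<le> n"
    then show "L2_sq (\<lambda>x. f m x - f n x) < e"
      using L2_sq_triangle[of "f m" g "f n"] K[of m] K[of n] a
      by (simp add: L2_sq_minus_commute[of g "f n"])
  qed
qed

text \<open>Fatou's lemma is applied to \<open>f m - f n\<close> with \<open>m\<close> fixed and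
  \<open>n\<close> tending to infinity; the index is shifted by \<open>K\<close> so that the Cauchy
  bound holds along the whole sequence. Besides completeness, this gives the tool for identifying an
  L2 limit with a pointwise limit that is already known.\<close>

lemma L2_Cauchy_pointwise_limit:
  assumes "L2_Cauchy f" and lim: "AE x in lebesgue. (\<lambda>k. f k x) \<longlonglongrightarrow> g x"
  shows "L2_tendsto f g"
proof -
  have f: "\<And>k. f k \<in> L2" using assms by (auto simp: L2_Cauchy_def)
  have *: "\<exists>K. \<forall>m\<ge>K. (\<lambda>x. f m x - g x) \<in> L2 \<and> L2_sq (\<lambda>x. f m x - g x) \<le> e" if "e > 0" for e
  proof -
    obtain K where K: "\<And>m n. m \<ge> K \<Longrightarrow> n \<ge> K \<Longrightarrow> L2_sq (\<lambda>x. f m x - f n x) < e"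
      using assms \<open>e > 0\<close> unfolding L2_Cauchy_def by blast
    have "(\<lambda>x. f m x - g x) \<in> L2 \<and> L2_sq (\<lambda>x. f m x - g x) \<le> e" if "m \<ge> K" for m
    proof (rule L2_Fatou)
      show "(\<lambda>x. f m x - f (k + K) x) \<in> L2" for k using f by (auto intro: L2_diff)
      show "L2_sq (\<lambda>x. f m x - f (k + K) x) \<le> e" for k
        using K[of m "k + K"] that by auto
      show "AE x in lebesgue. (\<lambda>k. f m x - f (k + K) x) \<longlonglongrightarrow> f m x - g x"
        using lim by eventually_elim (auto intro!: tendsto_intros LIMSEQ_ignore_initial_segment)
    qed
    then show ?thesis by blast
  qed
  obtain K where "(\<lambda>x. f K x - g x) \<in> L2" using *[of 1] by auto
  then have g: "g \<in> L2" using L2_diff[OF f[of K]] by fastforce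
  have "(\<lambda>k. L2_sq (\<lambda>x. f k x - g x)) \<longlonglongrightarrow> 0"
  proof (rule LIMSEQ_I)
    fix e :: real assume "e > 0"
    then obtain K where "\<forall>m\<ge>K. L2_sq (\<lambda>x. f m x - g x) \<le> e / 2" using *[of "e/2"] by auto
    then show "\<exists>no. \<forall>n\<ge>no. norm (L2_sq (\<lambda>x. f n x - g x) - 0) < e"
      using \<open>e > 0\<close> by (intro exI[of _ K]) fastforce
  qed
  then show ?thesis using f g by (simp add: L2_tendsto_iff)
qed

text \<open>With \<open>d k\<close> the distance of consecutive terms at a point, the series of
  \<open>2^k * (d k)^2\<close> has an integral of at most the sum of \<open>(1/4)^k\<close>, so it
  is finite almost everywhere. The weight \<open>2^k\<close> is what allows \<open>d k\<close>
  itself to be summed, since \<open>d k \<le> (1/2)^k + 2^k * (d k)^2\<close>; the telescoping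
  series then converges absolutely.\<close>

lemma L2_fast_Cauchy_AE_convergent:
  assumes f: "\<And>k. f k \<in> L2" and fast: "\<And>k. L2_sq (\<lambda>x. f (Suc k) x - f k x) \<le> (1/8)^k"
  shows "AE x in lebesgue. convergent (\<lambda>k. f k x)"
proof -
  note [measurable] = L2_D(1)[OF f]
  have "(\<integral>\<^sup>+x. (\<Sum>k. ennreal (2^k * (cmod (f (Suc k) x - f k x))\<^sup>2)) \<partial>lebesgue) =
        (\<Sum>k. \<integral>\<^sup>+x. ennreal (2^k * (cmod (f (Suc k) x - f k x))\<^sup>2) \<partial>lebesgue)"
    by (rule nn_integral_suminf) measurable
  also have "\<dots> \<le> (\<Sum>k. ennreal ((1/4)^k))"
  proof (rule suminf_le)
    fix k
    have d: "(\<lambda>x. f (Suc k) x - f k x) \<in> L2" using f by (auto intro: L2_diff)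
    have "(\<integral>\<^sup>+x. ennreal (2^k * (cmod (f (Suc k) x - f k x))\<^sup>2) \<partial>lebesgue) =
          ennreal (2^k * L2_sq (\<lambda>x. f (Suc k) x - f k x))"
      unfolding L2_sq_def integral_mult_right_zero[symmetric]
      by (rule nn_integral_eq_integral) (use L2_D(2)[OF d] in auto)
    also have "\<dots> \<le> ennreal (2^k * (1/8)^k)"
      by (intro ennreal_leI mult_left_mono fast) auto
    also have "2^k * (1/8)^k = (1/4::real)^k"
      by (simp flip: power_mult_distrib)
    finally show "(\<integral>\<^sup>+x. ennreal (2^k * (cmod (f (Suc k) x - f k x))\<^sup>2) \<partial>lebesgue) \<le> ennreal ((1/4)^k)" .
  qed auto
  also have "\<dots> = ennreal (\<Sum>k. (1/4)^k)"
    by (rule suminf_ennreal2) (auto intro: summable_geometric)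
  finally have fin: "(\<integral>\<^sup>+x. (\<Sum>k. ennreal (2^k * (cmod (f (Suc k) x - f k x))\<^sup>2)) \<partial>lebesgue) \<noteq> \<infinity>"
    by (auto simp: top_unique)
  have "AE x in lebesgue. (\<Sum>k. ennreal (2^k * (cmod (f (Suc k) x - f k x))\<^sup>2)) \<noteq> \<infinity>"
    by (rule nn_integral_noteq_infinite) (use fin in auto)
  then show ?thesis
  proof eventually_elim
    case (elim x)
    then have s: "summable (\<lambda>k. 2^k * (cmod (f (Suc k) x - f k x))\<^sup>2)"
      by (intro summable_suminf_not_top) auto
    have g: "summable (\<lambda>k. (1/2::real)^k)" by (auto intro: summable_geometric)
    have "summable (\<lambda>k. f (Suc k) x - f k x)"
    proof (rule summable_comparison_test[OF _ summable_add[OF g s]], intro exI allI impI)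
      fix k
      let ?d = "cmod (f (Suc k) x - f k x)"
      show "?d \<le> (1/2)^k + 2^k * ?d\<^sup>2"
      \<comment> \<open>In the second case \<open>2^k * ?d\<close> exceeds 1, so multiplying
        \<open>?d\<close> by it only enlarges it.\<close>
      proof (cases "?d \<le> (1/2)^k")
        case False
        then have "2^k * (1/2)^k * ?d \<le> 2^k * ?d * ?d"
          by (intro mult_right_mono mult_left_mono) auto
        moreover have "2^k * (1/2::real)^k = 1" by (simp flip: power_mult_distrib)
        ultimately have "?d \<le> 2^k * ?d\<^sup>2" by (simp add: power2_eq_square mult.assoc)
        then show ?thesis by (smt (verit) zero_le_power half_gt_zero_iff)
      qed (simp add: add_increasing2)
    qed
    then have "convergent (\<lambda>n. \<Sum>k<n. f (Suc k) x - f k x)"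
      by (simp add: summable_iff_convergent)
    then have "convergent (\<lambda>n. f n x - f 0 x)"
      by (subst (asm) sum_lessThan_telescope)
    then have "convergent (\<lambda>n. (f n x - f 0 x) + f 0 x)"
      by (intro convergent_add convergent_const)
    then show ?case by simp
  qed
qed

text \<open>The Riesz-Fischer argument: a fast subsequence converges almost everywhere, its
  pointwise limit is its L2 limit, and a Cauchy sequence follows its subsequence.\<close>

theorem L2_complete:
  assumes "L2_Cauchy f" shows "\<exists>g. L2_tendsto f g"
proof -
  have f: "\<And>k. f k \<in> L2" using assms by (auto simp: L2_Cauchy_def)
  have "\<forall>k. \<exists>K. \<forall>m\<ge>K. \<forall>n\<ge>K. L2_sq (\<lambda>x. f m x - f n x) < (1/8)^k"
    using assms by (auto simp: L2_Cauchy_def)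
  then obtain K where K: "\<And>k m n. m \<ge> K k \<Longrightarrow> n \<ge> K k \<Longrightarrow> L2_sq (\<lambda>x. f m x - f n x) < (1/8)^k"
    by metis
  \<comment> \<open>The sum makes \<open>\<phi> k\<close> dominate \<open>K k\<close>; the summand
    \<open>k\<close> makes \<open>\<phi>\<close> strictly increasing even if some \<open>K i\<close>
    vanish.\<close>
  define \<phi> where "\<phi> k = k + (\<Sum>i\<le>k. K i)" for k
  have \<phi>K: "K k \<le> \<phi> k" for k
    unfolding \<phi>_def by (rule trans_le_add2) (rule member_le_sum, auto)
  have \<phi>mono: "strict_mono \<phi>"
    by (rule strict_mono_Suc_iff[THEN iffD2]) (simp add: \<phi>_def)
  have "AE x in lebesgue. convergent (\<lambda>k. f (\<phi> k) x)"
  proof (rule L2_fast_Cauchy_AE_convergent)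
    show "L2_sq (\<lambda>x. f (\<phi> (Suc k)) x - f (\<phi> k) x) \<le> (1/8)^k" for k
      using K[of k "\<phi> (Suc k)" "\<phi> k"] \<phi>K[of k] strict_monoD[OF \<phi>mono, of k "Suc k"] by simp
  qed (rule f)
  then have lim: "AE x in lebesgue. (\<lambda>k. f (\<phi> k) x) \<longlonglongrightarrow> lim (\<lambda>k. f (\<phi> k) x)"
    by eventually_elim (simp add: convergent_LIMSEQ_iff)
  have "L2_Cauchy (\<lambda>k. f (\<phi> k))"
    unfolding L2_Cauchy_def
  proof (intro conjI allI impI f)
    fix e :: real assume "e > 0"
    then obtain N where N: "\<forall>m\<ge>N. \<forall>n\<ge>N. L2_sq (\<lambda>x. f m x - f n x) < e"
      using assms by (auto simp: L2_Cauchy_def)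
    show "\<exists>K. \<forall>m\<ge>K. \<forall>n\<ge>K. L2_sq (\<lambda>x. f (\<phi> m) x - f (\<phi> n) x) < e"
      using N seq_suble[OF \<phi>mono] order_trans by blast
  qed
  from L2_Cauchy_pointwise_limit[OF this lim]
  have sub: "L2_tendsto (\<lambda>k. f (\<phi> k)) (\<lambda>x. lim (\<lambda>k. f (\<phi> k) x))" (is "L2_tendsto _ ?g") .
  then have g: "?g \<in> L2" by (simp add: L2_tendsto_iff)
  have "(\<lambda>k. L2_sq (\<lambda>x. f k x - ?g x)) \<longlonglongrightarrow> 0"
  proof (rule LIMSEQ_I)
    fix e :: real assume "e > 0"
    \<comment> \<open>The squared triangle inequality doubles each of the two distances, hence
      \<open>e / 4\<close>.\<close>
    then obtain N where N: "\<And>m n. m \<ge> N \<Longrightarrow> n \<ge> N \<Longrightarrow> L2_sq (\<lambda>x. f m x - f n x) < e / 4"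
      using assms unfolding L2_Cauchy_def by (meson divide_pos_pos zero_less_numeral)
    obtain M where M: "\<And>k. k \<ge> M \<Longrightarrow> L2_sq (\<lambda>x. f (\<phi> k) x - ?g x) < e / 4"
      using L2_tendstoD[OF sub, of "e / 4"] \<open>e > 0\<close> by auto
    have "L2_sq (\<lambda>x. f n x - ?g x) < e" if "n \<ge> N" for n
    proof -
      let ?j = "\<phi> (max M N)"
      have "?j \<ge> N" using seq_suble[OF \<phi>mono, of "max M N"] by simp
      then show ?thesis
        using L2_sq_triangle[OF f[of n] f[of ?j] g] N[OF that, of ?j] M[of "max M N"] by simp
    qed
    then show "\<exists>no. \<forall>n\<ge>no. norm (L2_sq (\<lambda>x. f n x - ?g x) - 0) < e" by auto
  qed
  then show ?thesis using f g by (auto simp: L2_tendsto_iff)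
qed

lemma L2_tendsto_dominated:
  fixes f :: "nat \<Rightarrow> 'a::euclidean_space \<Rightarrow> complex"
  assumes f: "\<And>k. f k \<in> borel_measurable lebesgue" and w: "w \<in> L2"
    and lim: "AE x in lebesgue. (\<lambda>k. f k x) \<longlonglongrightarrow> g x"
    and bound: "\<And>k. AE x in lebesgue. cmod (f k x) \<le> cmod (w x)"
  shows "L2_tendsto f g"
proof -
  have g: "g \<in> borel_measurable lebesgue"
    using borel_measurable_lebesgue_AE_limit[OF f lim] .
  note [measurable] = f g
  have "AE x in lebesgue. \<forall>k. cmod (f k x) \<le> cmod (w x)"
    using bound by (simp add: AE_all_countable)
  with lim have gw: "AE x in lebesgue. cmod (g x) \<le> cmod (w x)"
  proof eventually_elim
    case (elim x)
    then show ?case by (intro LIMSEQ_le_const2[OF tendsto_norm[OF elim(1)]]) auto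
  qed
  have fL2: "f k \<in> L2" for k
    by (rule L2_bounded[OF w f, of _ 1]) (use bound in auto)
  have gL2: "g \<in> L2"
    by (rule L2_bounded[OF w g, of 1]) (use gw in auto)
  have "(\<lambda>k. LINT x|lebesgue. (cmod (f k x - g x))\<^sup>2) \<longlonglongrightarrow> (LINT x|(lebesgue :: 'a measure). (0::real))"
  proof (rule integral_dominated_convergence)
    show "integrable lebesgue (\<lambda>x. 4 * (cmod (w x))\<^sup>2)" using L2_D(2)[OF w] by simp
    show "AE x in lebesgue. (\<lambda>k. (cmod (f k x - g x))\<^sup>2) \<longlonglongrightarrow> 0"
      using lim
    proof eventually_elim
      case (elim x)
      have "(\<lambda>k. (cmod (f k x - g x))\<^sup>2) \<longlonglongrightarrow> (cmod (g x - g x))\<^sup>2"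
        using elim by (intro tendsto_intros)
      then show ?case by simp
    qed
    show "AE x in lebesgue. norm ((cmod (f k x - g x))\<^sup>2) \<le> 4 * (cmod (w x))\<^sup>2" for k
      using bound[of k] gw
    proof eventually_elim
      case (elim x)
      have "cmod (f k x - g x) \<le> 2 * cmod (w x)"
        using norm_triangle_ineq4[of "f k x" "g x"] elim by linarith
      then have "(cmod (f k x - g x))\<^sup>2 \<le> (2 * cmod (w x))\<^sup>2" by (intro power_mono) auto
      then show ?case by (simp add: power_mult_distrib)
    qed
  qed measurable
  then show ?thesis using fL2 gL2 by (simp add: L2_tendsto_iff L2_sq_def)
qed

text \<open>A weighted form of Young's inequality stands in for Cauchy-Schwarz: it comes from
  expanding the square of \<open>sqrt t * cmod (f x) - cmod (g x) / sqrt t\<close>. The weight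
  \<open>t\<close> stays free and is chosen by the application.\<close>

lemma
  assumes "f \<in> L2" "g \<in> L2" "t > 0"
  shows L2_mult_integrable: "integrable lebesgue (\<lambda>x. f x * g x)"
    and L2_mult_integral_le: "2 * cmod (LINT x|lebesgue. f x * g x) \<le> t * L2_sq f + L2_sq g / t"
proof -
  note [measurable] = L2_D(1)[OF assms(1)] L2_D(1)[OF assms(2)]
  note [simp] = L2_D(2)[OF assms(1)] L2_D(2)[OF assms(2)]
  have *: "2 * cmod (f x * g x) \<le> t * (cmod (f x))\<^sup>2 + (cmod (g x))\<^sup>2 / t" for x
  proof -
    have "0 \<le> (sqrt t * cmod (f x) - cmod (g x) / sqrt t)\<^sup>2" by simp
    also have "\<dots> = t * (cmod (f x))\<^sup>2 + (cmod (g x))\<^sup>2 / t - 2 * cmod (f x * g x)"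
      using \<open>t > 0\<close> by (simp add: power2_diff power_mult_distrib power_divide norm_mult)
    finally show ?thesis by simp
  qed
  have i: "integrable lebesgue (\<lambda>x. t * (cmod (f x))\<^sup>2 + (cmod (g x))\<^sup>2 / t)" by simp
  have le: "cmod (f x * g x) \<le> t * (cmod (f x))\<^sup>2 + (cmod (g x))\<^sup>2 / t" for x
    using *[of x] norm_ge_zero[of "f x * g x"] by linarith
  show j: "integrable lebesgue (\<lambda>x. f x * g x)"
  proof (rule Bochner_Integration.integrable_bound[OF i])
    show "AE x in lebesgue. norm (f x * g x) \<le> norm (t * (cmod (f x))\<^sup>2 + (cmod (g x))\<^sup>2 / t)"
      using order_trans[OF le abs_ge_self] by (intro AE_I2) simp
  qed measurable
  have "2 * cmod (LINT x|lebesgue. f x * g x) \<le> 2 * (LINT x|lebesgue. cmod (f x * g x))"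
    by simp
  also have "\<dots> = (LINT x|lebesgue. 2 * cmod (f x * g x))" by simp
  also have "\<dots> \<le> (LINT x|lebesgue. t * (cmod (f x))\<^sup>2 + (cmod (g x))\<^sup>2 / t)"
    by (rule integral_mono) (use i j * in auto)
  also have "\<dots> = t * L2_sq f + L2_sq g / t" by (simp add: L2_sq_def)
  finally show "2 * cmod (LINT x|lebesgue. f x * g x) \<le> t * L2_sq f + L2_sq g / t" .
qed

lemma L2_tendsto_integral_mult:
  assumes "L2_tendsto f g" "h \<in> L2"
  shows "(\<lambda>k. LINT x|lebesgue. f k x * h x) \<longlonglongrightarrow> (LINT x|lebesgue. g x * h x)"
proof (rule LIMSEQ_I)
  note a = assms(1)[unfolded L2_tendsto_iff]
  fix e :: real assume "e > 0"
  \<comment> \<open>This weight makes the term of \<open>h\<close> smaller than \<open>e\<close>;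
    the added 1 keeps \<open>t\<close> positive when \<open>h\<close> vanishes almost
    everywhere.\<close>
  define t where "t = (L2_sq h + 1) / e"
  have t: "t > 0" "L2_sq h / t < e"
    using \<open>e > 0\<close> L2_sq_nonneg[of h] unfolding t_def
    by (simp_all add: divide_simps add_nonneg_pos)
  obtain K where K: "\<And>k. k \<ge> K \<Longrightarrow> L2_sq (\<lambda>x. f k x - g x) < e / t"
    using L2_tendstoD[OF assms(1), of "e / t"] \<open>e > 0\<close> t by auto
  have "norm ((LINT x|lebesgue. f k x * h x) - (LINT x|lebesgue. g x * h x)) < e" if "k \<ge> K" for k
  proof -
    have "(LINT x|lebesgue. f k x * h x) - (LINT x|lebesgue. g x * h x) =
          (LINT x|lebesgue. (f k x - g x) * h x)"
      using a assms(2) by (simp add: left_diff_distrib L2_mult_integrable[OF _ _ zero_less_one])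
    moreover have "2 * cmod (LINT x|lebesgue. (f k x - g x) * h x) \<le>
        t * L2_sq (\<lambda>x. f k x - g x) + L2_sq h / t"
      using a assms(2) t by (intro L2_mult_integral_le L2_diff) auto
    moreover have "t * L2_sq (\<lambda>x. f k x - g x) < e"
      using K[OF that] t by (simp add: field_simps)
    ultimately show ?thesis using t by simp
  qed
  then show "\<exists>no. \<forall>k\<ge>no. norm ((LINT x|lebesgue. f k x * h x) - (LINT x|lebesgue. g x * h x)) < e"
    by blast
qed

lemma L2_of_bounded_integrable:
  assumes "integrable lebesgue f" "\<And>x. cmod (f x) \<le> B"
  shows "f \<in> L2"
proof -
  have "integrable lebesgue (\<lambda>x. (cmod (f x))\<^sup>2)"
  proof (rule Bochner_Integration.integrable_bound)
    show "integrable lebesgue (\<lambda>x. B * cmod (f x))" using assms(1) by simp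
    show "(\<lambda>x. (cmod (f x))\<^sup>2) \<in> borel_measurable lebesgue"
      using borel_measurable_integrable[OF assms(1)] by measurable
    have "0 \<le> B" using assms(2)[of 0] norm_ge_zero order_trans by blast
    then show "AE x in lebesgue. norm ((cmod (f x))\<^sup>2) \<le> norm (B * cmod (f x))"
      using assms(2) by (auto simp: power2_eq_square mult_right_mono)
  qed
  then show ?thesis using borel_measurable_integrable[OF assms(1)] by (simp add: L2_def)
qed

subsection \<open>Density of compactly supported continuous functions\<close>

definition Cc :: "('a::euclidean_space \<Rightarrow> complex) set" where
  "Cc = {f. continuous_on UNIV f \<and> (\<exists>R. \<forall>x. R < norm x \<longrightarrow> f x = 0)}"

lemma Cc_measurable: "f \<in> Cc \<Longrightarrow> f \<in> borel_measurable borel"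
  by (auto simp: Cc_def intro: borel_measurable_continuous_onI)

lemma Cc_bounded:
  fixes f :: "'a::euclidean_space \<Rightarrow> complex"
  assumes "f \<in> Cc" obtains B where "0 \<le> B" "\<And>x. cmod (f x) \<le> B"
proof -
  obtain R where c: "continuous_on UNIV f" and R: "\<And>x. R < norm x \<Longrightarrow> f x = 0"
    using assms by (auto simp: Cc_def)
  have "compact (f ` cball 0 R)"
    using c by (intro compact_continuous_image) (auto intro: continuous_on_subset)
  then obtain B where "B > 0" and B: "\<And>y. y \<in> f ` cball 0 R \<Longrightarrow> cmod y \<le> B"
    by (meson compact_imp_bounded bounded_pos)
  have "cmod (f x) \<le> B" for x
    using B[of "f x"] R[of x] \<open>B > 0\<close> by (cases "norm x \<le> R") auto
  then show ?thesis using that[of B] \<open>B > 0\<close> by auto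
qed

lemma integrable_indicator_cball: "integrable lborel (indicator (cball 0 R :: 'a::euclidean_space set) :: 'a \<Rightarrow> real)"
  using emeasure_bounded_finite[of "cball (0::'a) R"] by (intro integrable_real_indicator) auto

lemma Cc_integrable:
  fixes f :: "'a::euclidean_space \<Rightarrow> complex"
  assumes "f \<in> Cc" shows "integrable lborel f"
proof -
  obtain R where R: "\<And>x. R < norm x \<Longrightarrow> f x = 0"
    using assms by (auto simp: Cc_def)
  obtain B where B: "0 \<le> B" "\<And>x. cmod (f x) \<le> B" using Cc_bounded[OF assms] by metis
  show ?thesis
  proof (rule Bochner_Integration.integrable_bound)
    show "integrable lborel (\<lambda>x::'a. B * indicator (cball 0 R) x)"
      by (intro integrable_mult_right integrable_indicator_cball)
    show "f \<in> borel_measurable lborel" using Cc_measurable[OF assms] by simp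
    show "AE x in lborel. norm (f x) \<le> norm (B * indicator (cball 0 R) x)"
      using B R by (auto simp: indicator_def not_le)
  qed
qed

lemma Cc_L2:
  assumes "f \<in> Cc" shows "f \<in> L2"
proof -
  obtain B where "\<And>x. cmod (f x) \<le> B" using Cc_bounded[OF assms] by metis
  then show ?thesis
    by (intro L2_of_bounded_integrable) (use Cc_integrable[OF assms] in \<open>auto simp: integrable_completion\<close>)
qed

text \<open>Lebesgue measurability supplies continuous functions converging to \<open>u\<close> off
  a negligible set, but with no control of size or support. Clamping their values and multiplying by
  a cutoff repairs both without changing the limit, because \<open>u\<close> already obeys the same
  restrictions; dominated convergence then applies.\<close>

lemma Cc_dense_bounded:
  fixes u :: "'a::euclidean_space \<Rightarrow> complex"
  assumes u: "u \<in> borel_measurable lebesgue" and R: "R > 0"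
    and bound: "\<And>x. cmod (u x) \<le> R" and supp: "\<And>x. R < norm x \<Longrightarrow> u x = 0"
  shows "\<exists>f. (\<forall>k. f k \<in> Cc) \<and> L2_tendsto f u"
proof -
  have "u measurable_on UNIV"
    using u by (rule lebesgue_measurable_imp_measurable_on) auto
  then obtain N g where N: "negligible N" and g: "\<And>n. continuous_on UNIV (g n)"
    and lim: "\<And>x. x \<notin> N \<Longrightarrow> (\<lambda>n. g n x) \<longlonglongrightarrow> u x"
    unfolding measurable_on_def by auto
  \<comment> \<open>\<open>\<psi>\<close> is a continuous cutoff equal to 1 on the ball of radius
    \<open>R\<close> and to 0 beyond \<open>R + 1\<close>. The factor
    \<open>R / max R (cmod (g n x))\<close> is the continuous radial retraction of the values onto
    the disc of radius \<open>R\<close>.\<close>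
  define \<psi> where "\<psi> x = max 0 (min 1 (R + 1 - norm x))" for x :: 'a
  define f where "f n x = (\<psi> x * (R / max R (cmod (g n x)))) *\<^sub>R g n x" for n x
  have \<psi>: "0 \<le> \<psi> x" "\<psi> x \<le> 1" "norm x \<le> R \<Longrightarrow> \<psi> x = 1" "R + 1 < norm x \<Longrightarrow> \<psi> x = 0" for x
    by (auto simp: \<psi>_def)
  have cont: "continuous_on UNIV (f n)" for n
    unfolding f_def \<psi>_def using R by (intro continuous_intros g) auto
  have Cc: "f n \<in> Cc" for n
    using cont[of n] \<psi>(4) by (auto simp: Cc_def f_def intro!: exI[of _ "R + 1"])
  have le: "cmod (f n x) \<le> R * indicator (cball 0 (R + 1)) x" for n x
  proof -
    have "R * cmod (g n x) \<le> R * max R (cmod (g n x))" using R by (intro mult_left_mono) auto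
    then have "R / max R (cmod (g n x)) * cmod (g n x) \<le> R"
      using R by (simp add: divide_simps)
    then have "\<psi> x * (R / max R (cmod (g n x)) * cmod (g n x)) \<le> \<psi> x * R"
      using \<psi> by (intro mult_left_mono) auto
    also have "\<dots> \<le> R * indicator (cball 0 (R + 1)) x"
      using \<psi>[of x] R by (auto simp: indicator_def)
    finally show ?thesis using \<psi>[of x] R by (simp add: f_def mult.assoc)
  qed
  have w: "(\<lambda>x::'a. complex_of_real (R * indicator (cball 0 (R + 1)) x)) \<in> L2"
  proof (rule L2_of_bounded_integrable)
    have "integrable lborel (\<lambda>x::'a. complex_of_real (R * indicator (cball 0 (R + 1)) x))"
      by (intro integrable_of_real integrable_mult_right integrable_indicator_cball)
    then show "integrable lebesgue (\<lambda>x::'a. complex_of_real (R * indicator (cball 0 (R + 1)) x))"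
      by (subst integrable_completion) auto
    show "cmod (complex_of_real (R * indicator (cball 0 (R + 1)) x)) \<le> R" for x :: 'a
      using R by (simp add: norm_mult indicator_def)
  qed
  have "L2_tendsto f u"
  proof (rule L2_tendsto_dominated[OF _ w])
    show "f k \<in> borel_measurable lebesgue" for k
      using Cc_L2[OF Cc] L2_D by blast
    show "AE x in lebesgue. (\<lambda>k. f k x) \<longlonglongrightarrow> u x"
    proof (rule AE_I')
      show "N \<in> null_sets lebesgue" using N by (simp add: negligible_iff_null_sets)
      have "(\<lambda>k. f k x) \<longlonglongrightarrow> u x" if "x \<notin> N" for x
      proof -
        have "(\<lambda>k. f k x) \<longlonglongrightarrow> (\<psi> x * (R / max R (cmod (u x)))) *\<^sub>R u x"
          unfolding f_def using R by (intro tendsto_intros lim that) auto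
        also have "(\<psi> x * (R / max R (cmod (u x)))) *\<^sub>R u x = u x"
          using bound[of x] supp[of x] \<psi>(3)[of x] R by (cases "norm x \<le> R") (auto simp: max_def)
        finally show ?thesis .
      qed
      then show "{x \<in> space lebesgue. \<not> (\<lambda>k. f k x) \<longlonglongrightarrow> u x} \<subseteq> N" by auto
    qed
    show "AE x in lebesgue. cmod (f k x) \<le> cmod (complex_of_real (R * indicator (cball 0 (R + 1)) x))" for k
      using order_trans[OF le[of k] abs_ge_self] by (intro AE_I2) (simp only: norm_of_real)
  qed
  with Cc show ?thesis by blast
qed

text \<open>For each \<open>k\<close> one element of \<open>A\<close> within squared distance
  \<open>1 / (k + 1)\<close> of \<open>g k\<close> is picked. This splits the density proof into
  truncation and approximation of truncated functions.\<close>

lemma L2_tendsto_diagonal: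
  assumes "L2_tendsto g u" "\<And>k. \<exists>f. (\<forall>j. f j \<in> A) \<and> L2_tendsto f (g k)"
  shows "\<exists>f. (\<forall>k. f k \<in> A) \<and> L2_tendsto f u"
proof -
  have "\<exists>h. h \<in> A \<and> h \<in> L2 \<and> L2_sq (\<lambda>x. h x - g k x) < inverse (Suc k)" for k
  proof -
    obtain f where f: "\<forall>j. f j \<in> A" "L2_tendsto f (g k)" using assms(2) by blast
    obtain K where "\<And>j. j \<ge> K \<Longrightarrow> L2_sq (\<lambda>x. f j x - g k x) < inverse (Suc k)"
      using L2_tendstoD[OF f(2), of "inverse (Suc k)"] by auto
    then show ?thesis using f by (intro exI[of _ "f K"]) (auto simp: L2_tendsto_iff)
  qed
  then obtain h where h: "\<And>k. h k \<in> A" "\<And>k. h k \<in> L2"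
      "\<And>k. L2_sq (\<lambda>x. h k x - g k x) < inverse (Suc k)" by metis
  have g: "\<And>k. g k \<in> L2" "u \<in> L2" using assms by (auto simp: L2_tendsto_iff)
  have "L2_tendsto h u"
  proof (rule L2_tendstoI_le[OF h(2) g(2)])
    show "L2_sq (\<lambda>x. h k x - u x) \<le> 2 * inverse (Suc k) + 2 * L2_sq (\<lambda>x. g k x - u x)" for k
      using L2_sq_triangle[OF h(2)[of k] g(1)[of k] g(2)] h(3)[of k] by linarith
    show "(\<lambda>k. 2 * inverse (Suc k) + 2 * L2_sq (\<lambda>x. g k x - u x)) \<longlonglongrightarrow> 0"
      using tendsto_add[OF tendsto_mult_left[OF LIMSEQ_inverse_real_of_nat, of 2] tendsto_mult_left, of "\<lambda>k. L2_sq (\<lambda>x. g k x - u x)" 0 2] assms(1)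
      by (simp add: L2_tendsto_iff)
  qed
  with h(1) show ?thesis by blast
qed

theorem Cc_dense:
  fixes u :: "'a::euclidean_space \<Rightarrow> complex"
  assumes "u \<in> L2" shows "\<exists>f. (\<forall>k. f k \<in> Cc) \<and> L2_tendsto f u"
proof (rule L2_tendsto_diagonal)
  note [measurable] = L2_D(1)[OF assms]
  \<comment> \<open>Size and support are cut at the same number, as \<open>Cc_dense_bounded\<close>
    has a single \<open>R\<close>; the successor keeps that number positive.\<close>
  define g where "g k x = (if norm x \<le> Suc k \<and> cmod (u x) \<le> Suc k then u x else 0)" for k :: nat and x
  have meas: "g k \<in> borel_measurable lebesgue" for k
  proof -
    have "(\<lambda>x::'a. norm x) \<in> borel_measurable lebesgue"
      by (intro measurable_completion) simp
    then show ?thesis unfolding g_def by measurable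
  qed
  show "L2_tendsto g u"
  proof (rule L2_tendsto_dominated[OF meas assms])
    have "(\<lambda>k. g k x) \<longlonglongrightarrow> u x" for x
    proof (rule tendsto_eventually)
      obtain K :: nat where "max (norm x) (cmod (u x)) \<le> K" using real_arch_simple by blast
      then show "\<forall>\<^sub>F k in sequentially. g k x = u x"
        by (intro eventually_sequentiallyI[of K]) (auto simp: g_def)
    qed
    then show "AE x in lebesgue. (\<lambda>k. g k x) \<longlonglongrightarrow> u x" by simp
    show "AE x in lebesgue. cmod (g k x) \<le> cmod (u x)" for k by (auto simp: g_def)
  qed
  show "\<exists>f. (\<forall>j. f j \<in> Cc) \<and> L2_tendsto f (g k)" for k
    by (rule Cc_dense_bounded[OF meas, of "Suc k"]) (auto simp: g_def)
qed

subsection \<open>Gaussians and their transforms\<close>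

abbreviation fourier_kernel :: "'a::euclidean_space \<Rightarrow> 'a \<Rightarrow> complex" where
  "fourier_kernel x \<xi> \<equiv> exp (- (\<i> * complex_of_real (x \<bullet> \<xi>)))"

lemma cmod_fourier_kernel [simp]: "cmod (fourier_kernel x \<xi>) = 1"
  by (simp add: norm_exp_eq_Re)

text \<open>Fubini's theorem and changes of variables are carried out over \<open>lborel\<close> for
  Borel functions, whereas the definitions integrate over \<open>lebesgue\<close>. For Borel
  integrands the two integrals agree.\<close>

lemma fourier_lborel:
  assumes "f \<in> borel_measurable borel"
  shows "fourier f \<xi> = (LINT x|lborel. f x * fourier_kernel x \<xi>)"
  unfolding fourier_def by (rule integral_completion) (use assms in measurable)

lemma conv_lborel:
  assumes "f \<in> borel_measurable borel" "g \<in> borel_measurable borel"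
  shows "conv f g x = (LINT y|lborel. f y * g (x - y))"
  unfolding conv_def by (rule integral_completion) (use assms in measurable)

text \<open>\<open>lborel\<close> is the image of a finite product of one-dimensional Lebesgue
  measures under the coordinate map \<open>?T\<close>, so integrals of products of functions of
  single coordinates factor. This reduces Gaussian integrals to dimension one.\<close>

lemma
  fixes g :: "'a::euclidean_space \<Rightarrow> real \<Rightarrow> complex"
  assumes g: "\<And>b. b \<in> Basis \<Longrightarrow> integrable lborel (g b)"
  shows lborel_integral_prod_Basis:
      "(LINT x|lborel. (\<Prod>b\<in>Basis. g b (x \<bullet> b))) = (\<Prod>b\<in>Basis. LINT s|lborel. g b s)"
    and lborel_integrable_prod_Basis: "integrable lborel (\<lambda>x::'a. \<Prod>b\<in>Basis. g b (x \<bullet> b))"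
proof -
  interpret product_sigma_finite "\<lambda>_::'a. lborel :: real measure" ..
  have [measurable]: "g b \<in> borel_measurable borel" if "b \<in> Basis" for b
    using borel_measurable_integrable[OF g[OF that]] by simp
  let ?T = "\<lambda>f::'a \<Rightarrow> real. \<Sum>b\<in>Basis. f b *\<^sub>R b"
  have T: "?T \<in> (\<Pi>\<^sub>M b\<in>Basis. lborel) \<rightarrow>\<^sub>M borel" by measurable
  have eq: "(\<Prod>b\<in>Basis. g b (?T f \<bullet> b)) = (\<Prod>b\<in>Basis. g b (f b))" for f
    by (rule prod.cong) (auto simp: inner_sum_left_Basis)
  show "(LINT x|lborel. (\<Prod>b\<in>Basis. g b (x \<bullet> b))) = (\<Prod>b\<in>Basis. LINT s|lborel. g b s)"
    by (subst lborel_eq, subst integral_distr[OF T])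
      (auto simp only: eq intro!: product_integral_prod g, measurable)
  show "integrable lborel (\<lambda>x::'a. \<Prod>b\<in>Basis. g b (x \<bullet> b))"
    by (subst lborel_eq, subst integrable_distr_eq[OF T])
      (auto simp only: eq intro!: product_integrable_prod g, measurable)
qed

text \<open>The substitution that replaces \<open>s\<close> by \<open>\<sigma> * s\<close> turns the
  integral into the characteristic function of the standard normal distribution at
  \<open>- (\<sigma> * t)\<close>.\<close>

lemma
  assumes "\<sigma> > 0"
  shows integrable_normal_density_kernel:
      "integrable lborel (\<lambda>s. complex_of_real (normal_density 0 \<sigma> s) * exp (- (\<i> * complex_of_real (s * t))))"
    and integral_normal_density_kernel:
      "(LINT s|lborel. complex_of_real (normal_density 0 \<sigma> s) * exp (- (\<i> * complex_of_real (s * t)))) =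
       complex_of_real (exp (- (\<sigma>\<^sup>2 * t\<^sup>2) / 2))"
proof -
  show "integrable lborel (\<lambda>s. complex_of_real (normal_density 0 \<sigma> s) * exp (- (\<i> * complex_of_real (s * t))))"
  proof (rule Bochner_Integration.integrable_bound)
    show "integrable lborel (normal_density 0 \<sigma>)" using assms by (rule integrable_normal_density)
  qed (auto simp: norm_mult norm_exp_eq_Re)
  have "(LINT s|lborel. complex_of_real (normal_density 0 \<sigma> s) * exp (- (\<i> * complex_of_real (s * t)))) =
        \<bar>\<sigma>\<bar> *\<^sub>R (LINT s|lborel. complex_of_real (normal_density 0 \<sigma> (0 + \<sigma> * s)) *
            exp (- (\<i> * complex_of_real ((0 + \<sigma> * s) * t))))"
    using assms by (intro lborel_integral_real_affine) auto
  also have "\<dots> = (LINT s|lborel. std_normal_density s *\<^sub>R iexp ((- (\<sigma> * t)) * s))"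
    unfolding integral_scaleR_right[symmetric]
  proof (rule Bochner_Integration.integral_cong[OF refl])
    fix s :: real
    have "\<sigma> * normal_density 0 \<sigma> (\<sigma> * s) = std_normal_density s"
      using assms by (simp add: normal_density_def real_sqrt_mult power_mult_distrib)
    then have *: "complex_of_real \<sigma> * complex_of_real (normal_density 0 \<sigma> (\<sigma> * s)) = complex_of_real (std_normal_density s)"
      by (metis of_real_mult)
    show "\<bar>\<sigma>\<bar> *\<^sub>R (complex_of_real (normal_density 0 \<sigma> (0 + \<sigma> * s)) *
            exp (- (\<i> * complex_of_real ((0 + \<sigma> * s) * t)))) = std_normal_density s *\<^sub>R iexp ((- (\<sigma> * t)) * s)"
    proof -
      have "- (\<i> * complex_of_real ((0 + \<sigma> * s) * t)) = \<i> * complex_of_real ((- (\<sigma> * t)) * s)"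
        by simp
      then show ?thesis
        using assms unfolding scaleR_conv_of_real mult.assoc[symmetric] by (simp only: abs_of_pos add_0 *)
    qed
  qed
  also have "\<dots> = char std_normal_distribution (- (\<sigma> * t))"
    unfolding char_def by (rule integral_density[symmetric]) auto
  also have "\<dots> = complex_of_real (exp (- (\<sigma>\<^sup>2 * t\<^sup>2) / 2))"
    by (simp add: char_std_normal_distribution power_mult_distrib)
  finally show "(LINT s|lborel. complex_of_real (normal_density 0 \<sigma> s) * exp (- (\<i> * complex_of_real (s * t)))) =
       complex_of_real (exp (- (\<sigma>\<^sup>2 * t\<^sup>2) / 2))" .
qed

text \<open>Links the real power in the normalisation of \<open>gaussian\<close> with the natural
  power that a product over the basis produces.\<close>

lemma powr_neg_half_dim:
  assumes "A > 0" shows "A powr (- real n / 2) = (1 / sqrt A) ^ n"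
proof -
  have "1 / sqrt A = A powr (- 1 / 2)"
    using assms by (simp add: powr_minus powr_half_sqrt inverse_eq_divide)
  then show ?thesis using assms by (simp add: powr_power)
qed

lemma norm_sq_eq_sum_Basis: "(norm (x::'a::euclidean_space))\<^sup>2 = (\<Sum>b\<in>Basis. (x \<bullet> b)\<^sup>2)"
  unfolding power2_norm_eq_inner by (subst euclidean_inner) (simp add: power2_eq_square)

lemma gaussian_eq_prod:
  fixes x :: "'a::euclidean_space"
  assumes "\<sigma> > 0"
  shows "gaussian \<sigma> x = (\<Prod>b\<in>Basis. normal_density 0 \<sigma> (x \<bullet> b))"
proof -
  have "(\<Prod>b\<in>Basis. normal_density 0 \<sigma> (x \<bullet> b)) =
        (1 / sqrt (2 * pi * \<sigma>\<^sup>2)) ^ DIM('a) * exp (\<Sum>b\<in>Basis. - (x \<bullet> b)\<^sup>2 / (2 * \<sigma>\<^sup>2))"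
    by (simp only: normal_density_def prod.distrib prod_constant exp_sum finite_Basis diff_0_right)
  also have "(\<Sum>b\<in>Basis. - (x \<bullet> b)\<^sup>2 / (2 * \<sigma>\<^sup>2)) = - (norm x)\<^sup>2 / (2 * \<sigma>\<^sup>2)"
    by (simp add: norm_sq_eq_sum_Basis sum_negf flip: sum_divide_distrib)
  finally show ?thesis
    using assms by (simp only: gaussian_def) (subst powr_neg_half_dim, simp_all)
qed

lemma gaussian_kernel_eq_prod:
  fixes x :: "'a::euclidean_space"
  assumes "\<sigma> > 0"
  shows "complex_of_real (gaussian \<sigma> x) * fourier_kernel x \<xi> =
    (\<Prod>b\<in>Basis. complex_of_real (normal_density 0 \<sigma> (x \<bullet> b)) * exp (- (\<i> * complex_of_real ((x \<bullet> b) * (\<xi> \<bullet> b)))))"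
proof -
  have "- (\<i> * complex_of_real (x \<bullet> \<xi>)) = (\<Sum>b\<in>Basis. - (\<i> * complex_of_real ((x \<bullet> b) * (\<xi> \<bullet> b))))"
    unfolding sum_negf sum_distrib_left[symmetric] of_real_sum[symmetric] by (subst euclidean_inner) (rule refl)
  then have "fourier_kernel x \<xi> = (\<Prod>b\<in>Basis. exp (- (\<i> * complex_of_real ((x \<bullet> b) * (\<xi> \<bullet> b)))))"
    by (simp only: exp_sum finite_Basis)
  then show ?thesis
    by (simp only: gaussian_eq_prod[OF assms] prod.distrib of_real_prod)
qed

lemma
  fixes \<xi> :: "'a::euclidean_space"
  assumes "\<sigma> > 0"
  shows integrable_gaussian_kernel:
      "integrable lborel (\<lambda>x. complex_of_real (gaussian \<sigma> x) * fourier_kernel x \<xi>)"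
    and integral_gaussian_kernel:
      "(LINT x|lborel. complex_of_real (gaussian \<sigma> x) * fourier_kernel x \<xi>) =
       complex_of_real (exp (- (\<sigma>\<^sup>2 * (norm \<xi>)\<^sup>2) / 2))"
proof -
  show "integrable lborel (\<lambda>x. complex_of_real (gaussian \<sigma> x) * fourier_kernel x \<xi>)"
    unfolding gaussian_kernel_eq_prod[OF assms]
    by (rule lborel_integrable_prod_Basis) (rule integrable_normal_density_kernel[OF assms])
  have "(LINT x|lborel. complex_of_real (gaussian \<sigma> x) * fourier_kernel x \<xi>) =
     (\<Prod>b\<in>Basis. complex_of_real (exp (- (\<sigma>\<^sup>2 * (\<xi> \<bullet> b)\<^sup>2) / 2)))"
    unfolding gaussian_kernel_eq_prod[OF assms]
    by (subst lborel_integral_prod_Basis)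
      (simp_all only: integrable_normal_density_kernel[OF assms] integral_normal_density_kernel[OF assms])
  also have "\<dots> = complex_of_real (exp (\<Sum>b\<in>Basis. - (\<sigma>\<^sup>2 * (\<xi> \<bullet> b)\<^sup>2) / 2))"
    by (simp add: exp_sum)
  also have "(\<Sum>b\<in>Basis. - (\<sigma>\<^sup>2 * (\<xi> \<bullet> b)\<^sup>2) / 2) = - (\<sigma>\<^sup>2 * (norm \<xi>)\<^sup>2) / 2"
    by (simp add: norm_sq_eq_sum_Basis sum_negf sum_distrib_left flip: sum_divide_distrib)
  finally show "(LINT x|lborel. complex_of_real (gaussian \<sigma> x) * fourier_kernel x \<xi>) =
       complex_of_real (exp (- (\<sigma>\<^sup>2 * (norm \<xi>)\<^sup>2) / 2))" .
qed

lemma gaussian_nonneg [simp]: "0 \<le> gaussian \<sigma> x"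
  by (simp add: gaussian_def)

lemma gaussian_measurable [measurable]: "gaussian \<sigma> \<in> borel_measurable borel"
  unfolding gaussian_def by measurable

lemma gaussian_minus_commute: "gaussian \<sigma> (x - y) = gaussian \<sigma> (y - x)"
  by (simp add: gaussian_def norm_minus_commute)

lemma gaussian_le:
  fixes x :: "'a::euclidean_space"
  shows "gaussian \<sigma> x \<le> gaussian \<sigma> (0::'a)"
proof -
  have "exp (- (norm x)\<^sup>2 / (2 * \<sigma>\<^sup>2)) \<le> 1" by simp
  from mult_left_mono[OF this, of "(2 * pi * \<sigma>\<^sup>2) powr (- real DIM('a) / 2)"]
  show ?thesis by (simp add: gaussian_def)
qed

text \<open>Both facts are the Gaussian transform evaluated at frequency 0, where the kernel is
  1.\<close>

lemma
  assumes "\<sigma> > 0"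
  shows integrable_gaussian: "integrable lborel (gaussian \<sigma> :: 'a::euclidean_space \<Rightarrow> real)"
    and integral_gaussian: "(LINT x|lborel. gaussian \<sigma> (x::'a::euclidean_space)) = 1"
proof -
  have "integrable lborel (\<lambda>x::'a. complex_of_real (gaussian \<sigma> x))"
    using integrable_gaussian_kernel[OF assms, of "0::'a"] by (simp only: inner_zero_right of_real_0 mult_zero_right minus_zero exp_zero mult_1_right)
  then show "integrable lborel (gaussian \<sigma> :: 'a \<Rightarrow> real)"
    unfolding complex_of_real_integrable_eq .
  have "complex_of_real (LINT x|lborel. gaussian \<sigma> (x::'a)) = 1"
    using integral_gaussian_kernel[OF assms, of "0::'a"]
    by (simp add: integral_complex_of_real del: complex_of_real_integrable_eq)
  then show "(LINT x|lborel. gaussian \<sigma> (x::'a)) = 1"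
    unfolding of_real_eq_1_iff .
qed

lemma nn_integral_lborel_shift:
  fixes g :: "'a::euclidean_space \<Rightarrow> ennreal"
  assumes "g \<in> borel_measurable borel"
  shows "(\<integral>\<^sup>+x. g (x - y) \<partial>lborel) = (\<integral>\<^sup>+x. g x \<partial>lborel)"
proof -
  have "(\<integral>\<^sup>+x. g x \<partial>lborel) = (\<integral>\<^sup>+x. g x \<partial>distr lborel borel ((+) (- y)))"
    by (simp add: lborel_distr_plus)
  also have "\<dots> = (\<integral>\<^sup>+x. g (x - y) \<partial>lborel)"
    using assms by (subst nn_integral_distr) auto
  finally show ?thesis by simp
qed

lemma nn_integral_gaussian_shift:
  fixes y :: "'a::euclidean_space"
  assumes "\<sigma> > 0"
  shows "(\<integral>\<^sup>+x. ennreal (gaussian \<sigma> (x - y)) \<partial>lborel) = 1" "(\<integral>\<^sup>+x. ennreal (gaussian \<sigma> (y - x)) \<partial>lborel) = 1"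
proof -
  have "(\<integral>\<^sup>+x. ennreal (gaussian \<sigma> (x - y)) \<partial>lborel) = (\<integral>\<^sup>+x. ennreal (gaussian \<sigma> (x::'a)) \<partial>lborel)"
    by (rule nn_integral_lborel_shift) measurable
  also have "\<dots> = 1"
    using integrable_gaussian[OF assms, where 'a='a] integral_gaussian[OF assms, where 'a='a]
    by (subst nn_integral_eq_integral) auto
  finally show "(\<integral>\<^sup>+x. ennreal (gaussian \<sigma> (x - y)) \<partial>lborel) = 1" .
  then show "(\<integral>\<^sup>+x. ennreal (gaussian \<sigma> (y - x)) \<partial>lborel) = 1"
    by (subst gaussian_minus_commute)
qed

text \<open>This is the transform of \<open>gaussian \<epsilon>\<close>. It has a second role as an
  integrable factor on the frequency side that tends to 1 as \<epsilon> tends to 0.\<close>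

definition gauss_damp :: "real \<Rightarrow> 'a::euclidean_space \<Rightarrow> complex" where
  "gauss_damp \<epsilon> \<xi> = complex_of_real (exp (- (\<epsilon>\<^sup>2 * (norm \<xi>)\<^sup>2) / 2))"

lemma fourier_gaussian:
  assumes "\<sigma> > 0"
  shows "fourier (\<lambda>x. complex_of_real (gaussian \<sigma> x)) = gauss_damp \<sigma>"
  by (rule ext) (subst fourier_lborel, use integral_gaussian_kernel[OF assms] in \<open>auto simp: gauss_damp_def\<close>)

lemma gauss_damp_measurable [measurable]: "gauss_damp \<epsilon> \<in> borel_measurable borel"
  unfolding gauss_damp_def by measurable

lemma cmod_gauss_damp_le: "cmod (gauss_damp \<epsilon> \<xi>) \<le> 1"
  by (simp add: gauss_damp_def)

lemma gauss_damp_tendsto: "(\<lambda>k. gauss_damp (inverse (real (Suc k))) \<xi>) \<longlonglongrightarrow> 1"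
proof -
  have "(\<lambda>k. gauss_damp (inverse (real (Suc k))) \<xi>) \<longlonglongrightarrow> complex_of_real (exp (- (0\<^sup>2 * (norm \<xi>)\<^sup>2) / 2))"
    unfolding gauss_damp_def by (intro tendsto_intros LIMSEQ_inverse_real_of_nat) auto
  then show ?thesis by simp
qed

text \<open>Up to a constant the damping factor is again a Gaussian, of reciprocal width; its
  integrability and its own transform thus follow from the formulas for Gaussians.\<close>

lemma gauss_damp_eq_gaussian:
  fixes \<xi> :: "'a::euclidean_space"
  assumes "\<epsilon> > 0"
  shows "gauss_damp \<epsilon> \<xi> = complex_of_real ((2 * pi / \<epsilon>\<^sup>2) powr (real DIM('a) / 2)) * complex_of_real (gaussian (1 / \<epsilon>) \<xi>)"
proof -
  have "(2 * pi / \<epsilon>\<^sup>2) powr (real DIM('a) / 2) * (2 * pi / \<epsilon>\<^sup>2) powr (- real DIM('a) / 2) = 1"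
    using assms by (simp flip: powr_add)
  then have "(2 * pi / \<epsilon>\<^sup>2) powr (real DIM('a) / 2) * gaussian (1 / \<epsilon>) \<xi> = exp (- (\<epsilon>\<^sup>2 * (norm \<xi>)\<^sup>2) / 2)"
    unfolding gaussian_def mult.assoc[symmetric] using assms by (simp add: power_divide mult.commute)
  then show ?thesis by (simp add: gauss_damp_def flip: of_real_mult)
qed

lemma
  fixes z :: "'a::euclidean_space"
  assumes "\<epsilon> > 0"
  shows integrable_gauss_damp: "integrable lborel (gauss_damp \<epsilon> :: 'a \<Rightarrow> complex)"
    and integral_gauss_damp_kernel: "(LINT \<xi>|lborel. gauss_damp \<epsilon> \<xi> * fourier_kernel \<xi> z) =
      (2 * pi) ^ DIM('a) * complex_of_real (gaussian \<epsilon> z)"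
proof -
  have e: "1 / \<epsilon> > 0" using assms by simp
  let ?K = "(2 * pi / \<epsilon>\<^sup>2) powr (real DIM('a) / 2)"
  have "integrable lborel (\<lambda>x::'a. complex_of_real (gaussian (1 / \<epsilon>) x))"
    using integrable_gaussian[OF e, where 'a='a] by (rule integrable_of_real)
  then show "integrable lborel (gauss_damp \<epsilon> :: 'a \<Rightarrow> complex)"
    unfolding gauss_damp_eq_gaussian[OF assms, abs_def] by simp
  have "(LINT \<xi>|lborel. gauss_damp \<epsilon> \<xi> * fourier_kernel \<xi> z) =
      complex_of_real (?K * exp (- ((1 / \<epsilon>)\<^sup>2 * (norm z)\<^sup>2) / 2))"
    unfolding gauss_damp_eq_gaussian[OF assms] mult.assoc integral_mult_right_zero
      integral_gaussian_kernel[OF e] of_real_mult ..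
  \<comment> \<open>Here \<open>(2 * pi) ^ DIM('a)\<close> arises: with \<open>n\<close> the
    dimension it is the product of \<open>(2 * pi / \<epsilon>^2)^(n/2)\<close>, the constant of the
    damping factor, and \<open>(2 * pi * \<epsilon>^2)^(n/2)\<close>, which the normalisation of
    \<open>gaussian \<epsilon>\<close> divides out.\<close>
  also have "?K * exp (- ((1 / \<epsilon>)\<^sup>2 * (norm z)\<^sup>2) / 2) = (2 * pi) ^ DIM('a) * gaussian \<epsilon> z"
  proof -
    have "(2 * pi) ^ DIM('a) = (2 * pi) powr real DIM('a)"
      by (simp add: powr_realpow)
    also have "\<dots> = ((2 * pi)\<^sup>2) powr (real DIM('a) / 2)"
      using powr_powr[of "2 * pi" 2 "real DIM('a) / 2"] by simp
    also have "(2 * pi)\<^sup>2 = (2 * pi / \<epsilon>\<^sup>2) * (2 * pi * \<epsilon>\<^sup>2)"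
      using assms by (simp add: power2_eq_square field_simps)
    also have "\<dots> powr (real DIM('a) / 2) = ?K * (2 * pi * \<epsilon>\<^sup>2) powr (real DIM('a) / 2)"
      using assms by (subst powr_mult) auto
    finally have "(2 * pi) ^ DIM('a) * (2 * pi * \<epsilon>\<^sup>2) powr (- real DIM('a) / 2) =
        ?K * ((2 * pi * \<epsilon>\<^sup>2) powr (real DIM('a) / 2) * (2 * pi * \<epsilon>\<^sup>2) powr (- real DIM('a) / 2))"
      by simp
    also have "(2 * pi * \<epsilon>\<^sup>2) powr (real DIM('a) / 2) * (2 * pi * \<epsilon>\<^sup>2) powr (- real DIM('a) / 2) = 1"
      using assms by (simp flip: powr_add)
    finally show ?thesis
      unfolding gaussian_def mult.assoc[symmetric] using assms by (simp add: power_divide)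
  qed
  finally show "(LINT \<xi>|lborel. gauss_damp \<epsilon> \<xi> * fourier_kernel \<xi> z) =
      (2 * pi) ^ DIM('a) * complex_of_real (gaussian \<epsilon> z)" by simp
qed

section \<open>Fubini's theorem for bounded kernels and the regularised inverse transform\<close>

lemma integrable_lborel_bounded_mult:
  fixes f g :: "'a::euclidean_space \<Rightarrow> complex"
  assumes "integrable lborel f" "g \<in> borel_measurable borel" "\<And>x. cmod (g x) \<le> B"
  shows "integrable lborel (\<lambda>x. g x * f x)"
proof (rule Bochner_Integration.integrable_bound)
  show "integrable lborel (\<lambda>x. B * cmod (f x))" using assms(1) by simp
  show "(\<lambda>x. g x * f x) \<in> borel_measurable lborel"
    using borel_measurable_integrable[OF assms(1)] assms(2) by simp
  show "AE x in lborel. norm (g x * f x) \<le> norm (B * cmod (f x))"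
    unfolding norm_mult real_norm_def
    by (intro AE_I2 order_trans[OF _ abs_ge_self]) (simp add: mult_right_mono assms(3))
qed

text \<open>As the kernel is at most 1 in modulus, the integrable function
  \<open>f y * h \<xi>\<close> dominates the double integrand. The kernel is left general because
  both the Fourier kernel and its conjugate are inserted.\<close>

lemma integral_kernel_swap:
  fixes f h :: "'a::euclidean_space \<Rightarrow> complex"
  assumes f: "integrable lborel f" and h: "integrable lborel h"
    and k: "case_prod k \<in> borel_measurable (borel \<Otimes>\<^sub>M borel)" and k1: "\<And>y \<xi>. cmod (k y \<xi>) \<le> 1"
  shows "(LINT \<xi>|lborel. (LINT y|lborel. f y * k y \<xi>) * h \<xi>) = (LINT y|lborel. f y * (LINT \<xi>|lborel. k y \<xi> * h \<xi>))"
proof -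
  have [measurable]: "f \<in> borel_measurable borel" "h \<in> borel_measurable borel"
    "case_prod k \<in> borel_measurable (borel \<Otimes>\<^sub>M borel)"
    using borel_measurable_integrable[OF f] borel_measurable_integrable[OF h] k by simp_all
  have fh: "integrable (lborel \<Otimes>\<^sub>M lborel) (\<lambda>p. f (fst p) * h (snd p))"
    by (rule lborel_pair.Fubini_integrable) (use f h in \<open>auto simp: norm_mult\<close>)
  have "integrable (lborel \<Otimes>\<^sub>M lborel) (\<lambda>(y, \<xi>). f y * k y \<xi> * h \<xi>)"
  proof (rule Bochner_Integration.integrable_bound[OF fh])
    have "cmod (f y) * cmod (k y \<xi>) * cmod (h \<xi>) \<le> cmod (f y) * cmod (h \<xi>)" for y \<xi>
      using k1[of y \<xi>] by (intro mult_right_mono mult_left_le) auto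
    then show "AE p in lborel \<Otimes>\<^sub>M lborel. norm (case p of (y, \<xi>) \<Rightarrow> f y * k y \<xi> * h \<xi>) \<le> norm (f (fst p) * h (snd p))"
      by (auto simp: norm_mult split: prod.split)
  qed measurable
  from lborel_pair.Fubini_integral[OF this]
  have "(LINT \<xi>|lborel. LINT y|lborel. f y * k y \<xi> * h \<xi>) = (LINT y|lborel. LINT \<xi>|lborel. f y * k y \<xi> * h \<xi>)" .
  then show ?thesis
    by (simp only: mult.assoc integral_mult_left_zero[symmetric] integral_mult_right_zero[symmetric])
qed

lemma fourier_measurable:
  fixes f :: "'a::euclidean_space \<Rightarrow> complex"
  assumes [measurable]: "f \<in> borel_measurable borel"
  shows "fourier f \<in> borel_measurable borel"
  unfolding fourier_lborel[OF assms, abs_def] by measurable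

lemma cmod_fourier_le: "cmod (fourier f \<xi>) \<le> (LINT x|lebesgue. cmod (f x))"
  unfolding fourier_def
  by (rule order_trans[OF integral_norm_bound]) (simp add: norm_mult)

text \<open>The multiplication formula: the kernel is symmetric in its two arguments, so exchanging
  the integrations moves the transform from one factor to the other.\<close>

lemma integral_fourier_mult:
  fixes f h :: "'a::euclidean_space \<Rightarrow> complex"
  assumes f: "integrable lborel f" and h: "integrable lborel h"
  shows "(LINT \<xi>|lborel. fourier f \<xi> * h \<xi>) = (LINT x|lborel. f x * fourier h x)"
proof -
  have m: "f \<in> borel_measurable borel" "h \<in> borel_measurable borel"
    using borel_measurable_integrable[OF f] borel_measurable_integrable[OF h] by simp_all
  show ?thesis
    unfolding fourier_lborel[OF m(1)] fourier_lborel[OF m(2)]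
    by (subst integral_kernel_swap[OF f h]) (auto simp: inner_commute mult.commute)
qed

lemma cnj_measurable [measurable (raw)]:
  "f \<in> borel_measurable M \<Longrightarrow> (\<lambda>x. cnj (f x)) \<in> borel_measurable M"
  by (rule borel_measurable_continuous_on[of cnj]) (auto intro!: continuous_intros)

lemma integrable_fourier_damp:
  fixes f :: "'a::euclidean_space \<Rightarrow> complex"
  assumes f: "integrable lborel f" and \<epsilon>: "\<epsilon> > 0"
  shows "integrable lborel (\<lambda>\<xi>. cnj (fourier f \<xi>) * gauss_damp \<epsilon> \<xi>)"
proof -
  have [measurable]: "f \<in> borel_measurable borel" using borel_measurable_integrable[OF f] by simp
  note [measurable] = fourier_measurable[of f]
  show ?thesis
    by (rule integrable_lborel_bounded_mult[OF integrable_gauss_damp[OF \<epsilon>]])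
      (use cmod_fourier_le[of f] in auto)
qed

text \<open>Writing the conjugate of \<open>fourier f\<close> with the conjugate kernel and
  exchanging the integrals leaves, for each \<open>y\<close>, the transform of
  \<open>gauss_damp \<epsilon>\<close> at \<open>x - y\<close>. Because of the conjugation the
  argument is the difference needed for a convolution, without a reflection.\<close>

lemma fourier_regularized:
  fixes f :: "'a::euclidean_space \<Rightarrow> complex"
  assumes f: "integrable lborel f" and \<epsilon>: "\<epsilon> > 0"
  shows "fourier (\<lambda>\<xi>. cnj (fourier f \<xi>) * gauss_damp \<epsilon> \<xi>) x =
     (2 * pi) ^ DIM('a) * conv (\<lambda>y. cnj (f y)) (\<lambda>y. complex_of_real (gaussian \<epsilon> y)) x"
proof -
  have m [measurable]: "f \<in> borel_measurable borel" using borel_measurable_integrable[OF f] by simp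
  note [measurable] = fourier_measurable[of f]
  have "fourier (\<lambda>\<xi>. cnj (fourier f \<xi>) * gauss_damp \<epsilon> \<xi>) x =
      (LINT \<xi>|lborel. cnj (fourier f \<xi>) * (gauss_damp \<epsilon> \<xi> * fourier_kernel \<xi> x))"
    by (subst fourier_lborel) (auto simp: mult.assoc)
  also have "\<dots> = (LINT \<xi>|lborel. (LINT y|lborel. cnj (f y) * cnj (fourier_kernel y \<xi>)) * (gauss_damp \<epsilon> \<xi> * fourier_kernel \<xi> x))"
    unfolding fourier_lborel[OF m]
    by (simp only: complex_cnj_mult[symmetric] Bochner_Integration.integral_cnj)
  also have "\<dots> = (LINT y|lborel. cnj (f y) * (LINT \<xi>|lborel. cnj (fourier_kernel y \<xi>) * (gauss_damp \<epsilon> \<xi> * fourier_kernel \<xi> x)))"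
  proof (rule integral_kernel_swap)
    show "integrable lborel (\<lambda>y. cnj (f y))" using f by simp
    show "integrable lborel (\<lambda>\<xi>. gauss_damp \<epsilon> \<xi> * fourier_kernel \<xi> x)"
      using integrable_lborel_bounded_mult[OF integrable_gauss_damp[OF \<epsilon>], of "\<lambda>\<xi>. fourier_kernel \<xi> x" 1]
      by (simp add: mult.commute)
  qed auto
  also have "\<dots> = (LINT y|lborel. cnj (f y) * ((2 * pi) ^ DIM('a) * complex_of_real (gaussian \<epsilon> (x - y))))"
  proof -
    have "cnj (fourier_kernel y \<xi>) * (gauss_damp \<epsilon> \<xi> * fourier_kernel \<xi> x) = gauss_damp \<epsilon> \<xi> * fourier_kernel \<xi> (x - y)"
      for y \<xi>
      by (simp add: exp_cnj inner_diff_right inner_commute algebra_simps flip: exp_add)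
    then show ?thesis by (simp only: integral_gauss_damp_kernel[OF \<epsilon>])
  qed
  also have "\<dots> = (2 * pi) ^ DIM('a) * (LINT y|lborel. cnj (f y) * complex_of_real (gaussian \<epsilon> (x - y)))"
    by (subst integral_mult_right_zero[symmetric]) (simp add: mult_ac)
  finally show ?thesis by (subst conv_lborel) auto
qed

subsection \<open>The integral transform on integrable functions in \<open>L2\<close>\<close>

text \<open>With the right-hand side in the extended reals, divergence needs no exclusion: a
  non-integrable integrand makes \<open>conv\<close> equal to 0 and the bound trivial.\<close>

lemma cmod_conv_le:
  fixes f g :: "'a::euclidean_space \<Rightarrow> complex"
  assumes "f \<in> borel_measurable borel" "g \<in> borel_measurable borel"
  shows "ennreal (cmod (conv f g x)) \<le> (\<integral>\<^sup>+y. ennreal (cmod (f y) * cmod (g (x - y))) \<partial>lborel)"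
proof (cases "integrable lborel (\<lambda>y. f y * g (x - y))")
  case True
  then show ?thesis
    unfolding conv_lborel[OF assms] norm_mult[symmetric] by (rule integral_norm_bound_ennreal)
next
  case False
  then show ?thesis by (simp add: conv_lborel[OF assms] not_integrable_integral_eq)
qed

text \<open>A Schur test: \<open>2 * cmod (f x) * cmod (f y)\<close> is at most the sum of the two
  squares, and the Gaussian has integral 1 in each variable separately, so each square contributes
  exactly \<open>L2_sq f\<close>.\<close>

lemma gaussian_quadratic_form_le:
  fixes f :: "'a::euclidean_space \<Rightarrow> complex"
  assumes f: "integrable lborel f" and fL2: "f \<in> L2" and \<epsilon>: "\<epsilon> > 0"
  shows "cmod (LINT x|lborel. f x * conv (\<lambda>y. cnj (f y)) (\<lambda>y. complex_of_real (gaussian \<epsilon> y)) x) \<le> L2_sq f"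
    (is "cmod (LINT x|lborel. f x * ?c x) \<le> _")
proof -
  have m [measurable]: "f \<in> borel_measurable borel" using borel_measurable_integrable[OF f] by simp
  define A where "A x = ennreal ((cmod (f x))\<^sup>2)" for x
  define G where "G x = ennreal (gaussian \<epsilon> (x :: 'a))" for x
  have [measurable]: "A \<in> borel_measurable borel" "G \<in> borel_measurable borel"
    unfolding A_def G_def by measurable
  have intA: "(\<integral>\<^sup>+x. A x \<partial>lborel) = ennreal (L2_sq f)"
  proof -
    have "(\<integral>\<^sup>+x. A x \<partial>lborel) = (\<integral>\<^sup>+x. A x \<partial>lebesgue)" by (simp add: nn_integral_completion)
    also have "\<dots> = ennreal (L2_sq f)"
      unfolding A_def L2_sq_def using L2_D(2)[OF fL2] by (intro nn_integral_eq_integral) auto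
    finally show ?thesis .
  qed
  \<comment> \<open>The factor 2 is carried along so that the inequality between product and squares
    needs no division in \<open>ennreal\<close>.\<close>
  have "2 * ennreal (cmod (LINT x|lborel. f x * ?c x)) \<le> 2 * (\<integral>\<^sup>+x. ennreal (cmod (f x * ?c x)) \<partial>lborel)"
  proof (cases "integrable lborel (\<lambda>x. f x * ?c x)")
    case True
    then show ?thesis by (intro mult_left_mono integral_norm_bound_ennreal) auto
  next
    case False
    then show ?thesis by (simp add: not_integrable_integral_eq)
  qed
  also have "\<dots> \<le> 2 * (\<integral>\<^sup>+x. (\<integral>\<^sup>+y. ennreal (cmod (f x) * cmod (f y)) * G (x - y) \<partial>lborel) \<partial>lborel)"
  proof (intro mult_left_mono nn_integral_mono)
    fix x
    have "ennreal (cmod (f x * ?c x)) = ennreal (cmod (f x)) * ennreal (cmod (?c x))"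
      by (simp add: norm_mult ennreal_mult)
    also have "\<dots> \<le> ennreal (cmod (f x)) * (\<integral>\<^sup>+y. ennreal (cmod (cnj (f y)) * cmod (complex_of_real (gaussian \<epsilon> (x - y)))) \<partial>lborel)"
      by (intro mult_left_mono cmod_conv_le) auto
    also have "\<dots> = (\<integral>\<^sup>+y. ennreal (cmod (f x)) * ennreal (cmod (cnj (f y)) * cmod (complex_of_real (gaussian \<epsilon> (x - y)))) \<partial>lborel)"
      by (rule nn_integral_cmult[symmetric]) measurable
    also have "\<dots> = (\<integral>\<^sup>+y. ennreal (cmod (f x) * cmod (f y)) * G (x - y) \<partial>lborel)"
      by (intro nn_integral_cong) (simp add: G_def ennreal_mult mult.assoc)
    finally show "ennreal (cmod (f x * ?c x)) \<le> (\<integral>\<^sup>+y. ennreal (cmod (f x) * cmod (f y)) * G (x - y) \<partial>lborel)" .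
  qed auto
  also have "\<dots> = (\<integral>\<^sup>+x. (\<integral>\<^sup>+y. 2 * ennreal (cmod (f x) * cmod (f y)) * G (x - y) \<partial>lborel) \<partial>lborel)"
    by (simp add: nn_integral_cmult mult.assoc)
  also have "\<dots> \<le> (\<integral>\<^sup>+x. (\<integral>\<^sup>+y. A x * G (x - y) + A y * G (x - y) \<partial>lborel) \<partial>lborel)"
  proof (intro nn_integral_mono)
    fix x y
    have "2 * (cmod (f x) * cmod (f y)) \<le> (cmod (f x))\<^sup>2 + (cmod (f y))\<^sup>2"
      using sum_squares_bound[of "cmod (f x)" "cmod (f y)"] by (simp add: mult.assoc)
    then have "ennreal (2 * (cmod (f x) * cmod (f y))) \<le> A x + A y"
      unfolding A_def by (simp add: ennreal_leI flip: ennreal_plus)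
    then have "2 * ennreal (cmod (f x) * cmod (f y)) \<le> A x + A y"
      by (simp add: ennreal_mult)
    then show "2 * ennreal (cmod (f x) * cmod (f y)) * G (x - y) \<le> A x * G (x - y) + A y * G (x - y)"
      unfolding distrib_right[symmetric] by (rule mult_right_mono) simp
  qed
  also have "\<dots> = (\<integral>\<^sup>+x. (\<integral>\<^sup>+y. A x * G (x - y) \<partial>lborel) \<partial>lborel) + (\<integral>\<^sup>+x. (\<integral>\<^sup>+y. A y * G (x - y) \<partial>lborel) \<partial>lborel)"
    by (simp add: nn_integral_add)
  also have "(\<integral>\<^sup>+x. (\<integral>\<^sup>+y. A y * G (x - y) \<partial>lborel) \<partial>lborel) = (\<integral>\<^sup>+y. (\<integral>\<^sup>+x. A y * G (x - y) \<partial>lborel) \<partial>lborel)"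
    by (rule lborel_pair.Fubini'[symmetric]) measurable
  also have "\<dots> = (\<integral>\<^sup>+y. A y \<partial>lborel)"
    by (simp add: nn_integral_cmult nn_integral_gaussian_shift[OF \<epsilon>] G_def)
  also have "(\<integral>\<^sup>+x. (\<integral>\<^sup>+y. A x * G (x - y) \<partial>lborel) \<partial>lborel) = (\<integral>\<^sup>+y. A y \<partial>lborel)"
    by (simp add: nn_integral_cmult nn_integral_gaussian_shift[OF \<epsilon>] G_def)
  also have "(\<integral>\<^sup>+y. A y \<partial>lborel) + (\<integral>\<^sup>+y. A y \<partial>lborel) = 2 * ennreal (L2_sq f)"
    by (simp add: intA mult_2)
  finally have "ennreal (2 * cmod (LINT x|lborel. f x * ?c x)) \<le> ennreal (2 * L2_sq f)"
    by (simp add: ennreal_mult)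
  then show ?thesis by (subst (asm) ennreal_le_iff) auto
qed

text \<open>The Gaussian factor makes the double integral behind \<open>\<integral>|f^|\<^sup>2\<close> absolutely convergent; it is
  removed by Fatou's lemma.\<close>

lemma fourier_L2_bound_lborel:
  fixes f :: "'a::euclidean_space \<Rightarrow> complex"
  assumes f: "integrable lborel f" and fL2: "f \<in> L2"
  shows "fourier f \<in> L2 \<and> L2_sq (fourier f) \<le> (2 * pi) ^ DIM('a) * L2_sq f"
proof (rule L2_Fatou)
  have m [measurable]: "f \<in> borel_measurable borel" using borel_measurable_integrable[OF f] by simp
  note [measurable] = fourier_measurable[OF m]
  define e where "e k = inverse (real (Suc k))" for k
  have e: "e k > 0" for k by (simp add: e_def)
  \<comment> \<open>Dividing the parameter by \<open>sqrt 2\<close> makes the square of the damping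
    factor equal to \<open>gauss_damp (e k)\<close>, the factor in the regularised inverse
    transform.\<close>
  define g where "g k \<xi> = gauss_damp (e k / sqrt 2) \<xi> * fourier f \<xi>" for k \<xi>
  have [measurable]: "g k \<in> borel_measurable borel" for k unfolding g_def by measurable
  have damp_sq: "gauss_damp (e k / sqrt 2) \<xi> * gauss_damp (e k / sqrt 2) \<xi> = gauss_damp (e k) \<xi>" for k and \<xi> :: 'a
    by (simp add: gauss_damp_def power_divide flip: of_real_mult exp_add)
  have sq: "complex_of_real ((cmod (g k \<xi>))\<^sup>2) = fourier f \<xi> * (cnj (fourier f \<xi>) * gauss_damp (e k) \<xi>)" for k \<xi>
  proof -
    have "complex_of_real ((cmod (g k \<xi>))\<^sup>2) = g k \<xi> * cnj (g k \<xi>)"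
      by (rule complex_norm_square)
    also have "cnj (gauss_damp (e k / sqrt 2) \<xi>) = gauss_damp (e k / sqrt 2) \<xi>"
      by (simp add: gauss_damp_def)
    then have "g k \<xi> * cnj (g k \<xi>) = fourier f \<xi> * (cnj (fourier f \<xi>) *
        (gauss_damp (e k / sqrt 2) \<xi> * gauss_damp (e k / sqrt 2) \<xi>))"
      by (simp add: g_def mult_ac)
    finally show ?thesis by (simp only: damp_sq)
  qed
  have int_sq: "integrable lborel (\<lambda>\<xi>. (cmod (g k \<xi>))\<^sup>2)" for k
  proof -
    have "integrable lborel (\<lambda>\<xi>. complex_of_real ((cmod (g k \<xi>))\<^sup>2))"
      unfolding sq
      by (rule integrable_lborel_bounded_mult[OF integrable_fourier_damp[OF f e]])
        (use cmod_fourier_le[of f] in auto)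
    then show ?thesis by (simp only: complex_of_real_integrable_eq)
  qed
  show gL2: "g k \<in> L2" for k
    using int_sq[of k] by (simp add: L2_def integrable_completion measurable_completion)
  show "L2_sq (g k) \<le> (2 * pi) ^ DIM('a) * L2_sq f" for k
  proof -
    have "complex_of_real (L2_sq (g k)) = (LINT \<xi>|lborel. complex_of_real ((cmod (g k \<xi>))\<^sup>2))"
      unfolding L2_sq_def by (subst integral_completion) (auto simp only: integral_complex_of_real, measurable)
    \<comment> \<open>The multiplication formula moves the transform onto the damped conjugate,
      whose transform is known; what remains is the Gaussian quadratic form of
      \<open>f\<close>.\<close>
    also have "\<dots> = (LINT x|lborel. f x * fourier (\<lambda>\<xi>. cnj (fourier f \<xi>) * gauss_damp (e k) \<xi>) x)"
      unfolding sq by (rule integral_fourier_mult[OF f integrable_fourier_damp[OF f e]])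
    also have "\<dots> = (2 * pi) ^ DIM('a) *
        (LINT x|lborel. f x * conv (\<lambda>y. cnj (f y)) (\<lambda>y. complex_of_real (gaussian (e k) y)) x)"
      unfolding fourier_regularized[OF f e] integral_mult_right_zero[symmetric]
      by (simp only: mult.left_commute)
    finally have "cmod (complex_of_real (L2_sq (g k))) = (2 * pi) ^ DIM('a) *
        cmod (LINT x|lborel. f x * conv (\<lambda>y. cnj (f y)) (\<lambda>y. complex_of_real (gaussian (e k) y)) x)"
      by (simp add: norm_mult norm_power)
    also have "\<dots> \<le> (2 * pi) ^ DIM('a) * L2_sq f"
      by (intro mult_left_mono gaussian_quadratic_form_le f fL2 e) auto
    finally show ?thesis by simp
  qed
  have "(\<lambda>k. g k \<xi>) \<longlonglongrightarrow> fourier f \<xi>" for \<xi>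
  proof -
    have "(\<lambda>k. g k \<xi>) \<longlonglongrightarrow> complex_of_real (exp (- ((0 / sqrt 2)\<^sup>2 * (norm \<xi>)\<^sup>2) / 2)) * fourier f \<xi>"
      unfolding g_def gauss_damp_def e_def by (intro tendsto_intros LIMSEQ_inverse_real_of_nat) auto
    then show ?thesis by simp
  qed
  then show "AE \<xi> in lebesgue. (\<lambda>k. g k \<xi>) \<longlonglongrightarrow> fourier f \<xi>" by simp
qed

text \<open>Carries the bound for the transform from Borel functions, where Fubini's theorem was
  used, to Lebesgue measurable ones. Real and imaginary parts are treated separately because the
  result on completions concerns real functions.\<close>

lemma lebesgue_borel_representative:
  fixes f :: "'a::euclidean_space \<Rightarrow> complex"
  assumes [measurable]: "f \<in> borel_measurable lebesgue"
  obtains g where "g \<in> borel_measurable borel" "AE x in lebesgue. f x = g x"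
proof -
  have "(\<lambda>x. Re (f x)) \<in> borel_measurable (completion lborel)" "(\<lambda>x. Im (f x)) \<in> borel_measurable (completion lborel)"
    by measurable
  then obtain p q where "p \<in> borel_measurable lborel" "AE x in lborel. Re (f x) = p x"
      "q \<in> borel_measurable lborel" "AE x in lborel. Im (f x) = q x"
    by (metis completion_ex_borel_measurable_real)
  then have [measurable]: "p \<in> borel_measurable borel" "q \<in> borel_measurable borel"
    and ae: "AE x in lebesgue. Re (f x) = p x" "AE x in lebesgue. Im (f x) = q x"
    by (auto intro: AE_completion)
  show ?thesis
  proof
    show "(\<lambda>x. Complex (p x) (q x)) \<in> borel_measurable borel"
      unfolding Complex_eq by measurable
    show "AE x in lebesgue. f x = Complex (p x) (q x)"
      using ae by eventually_elim (simp add: complex_eq_iff)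
  qed
qed

lemma fourier_AE_cong:
  fixes f g :: "'a::euclidean_space \<Rightarrow> complex"
  assumes "f \<in> borel_measurable lebesgue" "AE x in lebesgue. f x = g x"
  shows "fourier f = fourier g"
proof
  fix \<xi> :: 'a
  have g: "g \<in> borel_measurable lebesgue"
    using borel_measurable_AE[OF assms] .
  have [measurable]: "(\<lambda>x. fourier_kernel x \<xi>) \<in> borel_measurable lebesgue"
    by (rule measurable_completion) measurable
  show "fourier f \<xi> = fourier g \<xi>"
    unfolding fourier_def
    by (rule integral_cong_AE) (use assms g in auto)
qed

theorem fourier_L2_bound:
  fixes f :: "'a::euclidean_space \<Rightarrow> complex"
  assumes f: "integrable lebesgue f" and fL2: "f \<in> L2"
  shows "fourier f \<in> L2" "L2_sq (fourier f) \<le> (2 * pi) ^ DIM('a) * L2_sq f"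
proof -
  have fm: "f \<in> borel_measurable lebesgue" using f by auto
  then obtain g where g: "g \<in> borel_measurable borel" "AE x in lebesgue. f x = g x"
    by (rule lebesgue_borel_representative)
  have gl: "g \<in> borel_measurable lebesgue" using borel_measurable_AE[OF fm g(2)] .
  have "integrable lebesgue g"
    using f g(2) integrable_cong_AE[OF fm gl] by simp
  then have "integrable lborel g" using g(1) by (simp add: integrable_completion)
  from fourier_L2_bound_lborel[OF this] L2_AE_cong[OF fL2 g(2)] fourier_AE_cong[OF fm g(2)]
  show "fourier f \<in> L2" "L2_sq (fourier f) \<le> (2 * pi) ^ DIM('a) * L2_sq f" by auto
qed

text \<open>The substitution \<open>y = x + e k *\<^sub>R z\<close> turns the convolution into an
  average of \<open>f (x + e k *\<^sub>R z)\<close> against the fixed density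
  \<open>gaussian 1\<close>. Continuity gives the pointwise limit and boundedness of
  \<open>f\<close> a dominating function.\<close>

lemma conv_gaussian_tendsto:
  fixes f :: "'a::euclidean_space \<Rightarrow> complex"
  assumes f: "f \<in> Cc"
  shows "(\<lambda>k. conv f (\<lambda>y. complex_of_real (gaussian (inverse (real (Suc k))) y)) x) \<longlonglongrightarrow> f x"
proof -
  have m [measurable]: "f \<in> borel_measurable borel" using Cc_measurable[OF f] .
  obtain B where B: "\<And>x. cmod (f x) \<le> B" using Cc_bounded[OF f] by metis
  have cont: "isCont f y" for y
    using f by (auto simp: Cc_def continuous_on_eq_continuous_at)
  define e where "e k = inverse (real (Suc k))" for k
  have e: "e k > 0" for k by (simp add: e_def)
  have eq: "conv f (\<lambda>y. complex_of_real (gaussian (e k) y)) x =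
      (LINT z|lborel. complex_of_real (gaussian 1 z) * f (x + e k *\<^sub>R z))" for k
  proof -
    \<comment> \<open>The Jacobian of the substitution cancels the dependence of the normalising
      constant on the width.\<close>
    have scale: "e k ^ DIM('a) * gaussian (e k) (- (e k *\<^sub>R z)) = gaussian 1 z" for z :: 'a
    proof -
      have "(2 * pi * (e k)\<^sup>2) powr (- real DIM('a) / 2) = (2 * pi) powr (- real DIM('a) / 2) * ((e k)\<^sup>2) powr (- real DIM('a) / 2)"
        by (subst powr_mult) auto
      moreover have "((e k)\<^sup>2) powr (- real DIM('a) / 2) * e k ^ DIM('a) = 1"
        using e[of k] by (subst powr_neg_half_dim) (auto simp: power_one_over)
      ultimately have "e k ^ DIM('a) * (2 * pi * (e k)\<^sup>2) powr (- real DIM('a) / 2) = (2 * pi) powr (- real DIM('a) / 2)"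
        by (simp add: mult_ac)
      moreover have "- (norm (- (e k *\<^sub>R z)))\<^sup>2 / (2 * (e k)\<^sup>2) = - (norm z)\<^sup>2 / (2 * 1\<^sup>2)"
        using e[of k] by (simp add: power_mult_distrib)
      ultimately show ?thesis
        unfolding gaussian_def mult.assoc[symmetric] by simp
    qed
    have "conv f (\<lambda>y. complex_of_real (gaussian (e k) y)) x =
        (LINT y|lborel. f y * complex_of_real (gaussian (e k) (x - y)))"
      by (rule conv_lborel) measurable
    also have "\<dots> = (LINT y|density (distr lborel borel (\<lambda>z. x + e k *\<^sub>R z)) (\<lambda>_. \<bar>e k\<bar> ^ DIM('a)).
        f y * complex_of_real (gaussian (e k) (x - y)))"
      using e[of k] by (subst lborel_affine[of "e k" x]) auto
    also have "\<dots> = (LINT z|lborel. (\<bar>e k\<bar> ^ DIM('a)) *\<^sub>R (f (x + e k *\<^sub>R z) * complex_of_real (gaussian (e k) (- (e k *\<^sub>R z)))))"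
      by (subst integral_density) (auto simp: integral_distr)
    also have "\<dots> = (LINT z|lborel. complex_of_real (gaussian 1 z) * f (x + e k *\<^sub>R z))"
    proof (rule Bochner_Integration.integral_cong[OF refl])
      fix z :: 'a
      show "(\<bar>e k\<bar> ^ DIM('a)) *\<^sub>R (f (x + e k *\<^sub>R z) * complex_of_real (gaussian (e k) (- (e k *\<^sub>R z)))) =
          complex_of_real (gaussian 1 z) * f (x + e k *\<^sub>R z)"
        unfolding scale[of z, symmetric] using e[of k] by (simp add: scaleR_conv_of_real mult_ac)
    qed
    finally show ?thesis .
  qed
  have "(\<lambda>k. LINT z|lborel. complex_of_real (gaussian 1 z) * f (x + e k *\<^sub>R z)) \<longlonglongrightarrow>
      (LINT z|(lborel :: 'a measure). complex_of_real (gaussian 1 z) * f x)"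
  proof (rule integral_dominated_convergence)
    show "integrable lborel (\<lambda>z::'a. gaussian 1 z * B)"
      using integrable_gaussian[of 1, where 'a='a] by simp
    have "(\<lambda>k. f (x + e k *\<^sub>R z)) \<longlonglongrightarrow> f x" for z
    proof (rule isCont_tendsto_compose[OF cont])
      have "(\<lambda>k. x + e k *\<^sub>R z) \<longlonglongrightarrow> x + 0 *\<^sub>R z"
        unfolding e_def by (intro tendsto_intros LIMSEQ_inverse_real_of_nat)
      then show "(\<lambda>k. x + e k *\<^sub>R z) \<longlonglongrightarrow> x" by simp
    qed
    then show "AE z in lborel. (\<lambda>k. complex_of_real (gaussian 1 z) * f (x + e k *\<^sub>R z)) \<longlonglongrightarrow> complex_of_real (gaussian 1 z) * f x"
      by (intro AE_I2 tendsto_intros)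
    show "AE z in lborel. norm (complex_of_real (gaussian 1 z) * f (x + e k *\<^sub>R z)) \<le> gaussian 1 z * B" for k
      using B by (intro AE_I2) (simp add: norm_mult mult_left_mono)
  qed measurable
  also have "(LINT z|(lborel :: 'a measure). complex_of_real (gaussian 1 z) * f x) = f x"
    unfolding integral_mult_left_zero integral_complex_of_real integral_gaussian[OF zero_less_one] by simp
  finally show ?thesis using eq unfolding e_def by simp
qed

lemma
  fixes f g :: "'a::euclidean_space \<Rightarrow> complex"
  assumes f: "integrable lborel f" and g: "integrable lborel g"
  shows integrable_conv: "integrable lborel (conv f g)"
    and fourier_conv: "fourier (conv f g) \<xi> = fourier f \<xi> * fourier g \<xi>"
proof -
  have m [measurable]: "f \<in> borel_measurable borel" "g \<in> borel_measurable borel"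
    using borel_measurable_integrable[OF f] borel_measurable_integrable[OF g] by simp_all
  have shift: "integrable lborel (\<lambda>x. h (x - y)) \<and> (LINT x|lborel. h (x - y)) = (LINT x|lborel. h x)"
    if h: "integrable lborel h" for h :: "'a \<Rightarrow> 'b::{banach, second_countable_topology}" and y
  proof -
    have [measurable]: "h \<in> borel_measurable borel" using borel_measurable_integrable[OF h] by simp
    have d: "distr lborel borel (\<lambda>x. x - y) = (lborel :: 'a measure)"
    proof -
      have "(\<lambda>x. x - y) = (+) (- y)" by auto
      then show ?thesis using lborel_distr_plus[of "- y"] by simp
    qed
    have "integrable lborel (\<lambda>x. h (x - y)) \<longleftrightarrow> integrable (distr lborel borel (\<lambda>x. x - y)) h"
      by (subst integrable_distr_eq) auto
    moreover have "(LINT x|lborel. h (x - y)) = (LINT x|distr lborel borel (\<lambda>x. x - y). h x)"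
      by (subst integral_distr) auto
    ultimately show ?thesis using h by (simp add: d)
  qed
  \<comment> \<open>The unimodular factor \<open>k\<close> makes one argument serve twice: with
    \<open>k = 1\<close> it gives integrability of the convolution, with the Fourier kernel the
    exchange of integrals for its transform.\<close>
  have pair: "integrable (lborel \<Otimes>\<^sub>M lborel) (\<lambda>(y, x). f y * (g (x - y) * k x))"
    if k: "k \<in> borel_measurable borel" "\<And>x. cmod (k x) = 1" for k
  proof (rule lborel_pair.Fubini_integrable)
    note [measurable] = k(1)
    show "(\<lambda>(y, x). f y * (g (x - y) * k x)) \<in> borel_measurable (lborel \<Otimes>\<^sub>M lborel)" by measurable
    have "(LINT x|lborel. cmod (f y * (g (x - y) * k x))) = cmod (f y) * (LINT x|lborel. cmod (g x))" for y
      using shift[of "\<lambda>x. cmod (g x)" y] g by (simp add: norm_mult k(2))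
    then show "integrable lborel (\<lambda>y. LINT x|lborel. norm (case (y, x) of (y, x) \<Rightarrow> f y * (g (x - y) * k x)))"
      using f by simp
    have "integrable lborel (\<lambda>x. k x * g (x - y))" for y
      by (rule integrable_lborel_bounded_mult[of _ _ 1]) (use shift[OF g] k in auto)
    then show "AE y in lborel. integrable lborel (\<lambda>x. case (y, x) of (y, x) \<Rightarrow> f y * (g (x - y) * k x))"
      by (simp add: mult.commute[of "g _"])
  qed
  have c: "conv f g = (\<lambda>x. LINT y|lborel. f y * g (x - y))"
    by (rule ext) (rule conv_lborel[OF m])
  show i: "integrable lborel (conv f g)"
    unfolding c using lborel_pair.integrable_snd[OF pair[of "\<lambda>_. 1"]] by simp
  then have [measurable]: "conv f g \<in> borel_measurable borel"
    using borel_measurable_integrable[OF i] by simp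
  have "fourier (conv f g) \<xi> = (LINT x|lborel. LINT y|lborel. f y * (g (x - y) * fourier_kernel x \<xi>))"
    by (subst fourier_lborel, measurable)
      (simp only: c integral_mult_left_zero[symmetric] mult.assoc)
  also have "\<dots> = (LINT y|lborel. LINT x|lborel. f y * (g (x - y) * fourier_kernel x \<xi>))"
    using lborel_pair.Fubini_integral[OF pair[of "\<lambda>x. fourier_kernel x \<xi>"]] by simp
  also have "\<dots> = (LINT y|lborel. (f y * fourier_kernel y \<xi>) * fourier g \<xi>)"
  proof (rule Bochner_Integration.integral_cong[OF refl])
    fix y
    have "integrable lborel (\<lambda>x. fourier_kernel x \<xi> * g x)"
      by (rule integrable_lborel_bounded_mult[OF g, of _ 1]) auto
    from shift[OF this, of y]
    have "(LINT x|lborel. fourier_kernel (x - y) \<xi> * g (x - y)) = fourier g \<xi>"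
      by (simp add: fourier_lborel[OF m(2)] mult.commute)
    then have "(f y * fourier_kernel y \<xi>) * fourier g \<xi> =
        (LINT x|lborel. (f y * fourier_kernel y \<xi>) * (fourier_kernel (x - y) \<xi> * g (x - y)))"
      by simp
    also have "\<dots> = (LINT x|lborel. f y * (g (x - y) * fourier_kernel x \<xi>))"
    proof (rule Bochner_Integration.integral_cong[OF refl])
      fix x
      have "fourier_kernel y \<xi> * fourier_kernel (x - y) \<xi> = fourier_kernel x \<xi>"
        by (simp add: inner_diff_left algebra_simps flip: exp_add)
      then show "(f y * fourier_kernel y \<xi>) * (fourier_kernel (x - y) \<xi> * g (x - y)) =
          f y * (g (x - y) * fourier_kernel x \<xi>)"
        by (metis mult.assoc mult.commute)
    qed
    finally show "(LINT x|lborel. f y * (g (x - y) * fourier_kernel x \<xi>)) = (f y * fourier_kernel y \<xi>) * fourier g \<xi>" ..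
  qed
  also have "\<dots> = fourier f \<xi> * fourier g \<xi>"
    by (simp only: integral_mult_left_zero fourier_lborel[OF m(1)])
  finally show "fourier (conv f g) \<xi> = fourier f \<xi> * fourier g \<xi>" .
qed

subsection \<open>The Fourier transform on \<open>L2\<close>\<close>

lemma has_fourier_L2_D:
  assumes "has_fourier_L2 u v" shows "u \<in> L2" "v \<in> L2"
  using assms by (auto simp: has_fourier_L2_def L2_tendsto_iff)

lemma integrable_lebesgue_kernel:
  fixes f :: "'a::euclidean_space \<Rightarrow> complex"
  assumes "integrable lebesgue f"
  shows "integrable lebesgue (\<lambda>x. f x * fourier_kernel x \<xi>)"
proof (rule Bochner_Integration.integrable_bound[OF assms])
  have [measurable]: "(\<lambda>x. fourier_kernel x \<xi>) \<in> borel_measurable lebesgue"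
    by (rule measurable_completion) measurable
  show "(\<lambda>x. f x * fourier_kernel x \<xi>) \<in> borel_measurable lebesgue"
    using assms by measurable
qed (simp add: norm_mult)

lemma fourier_add:
  assumes "integrable lebesgue f" "integrable lebesgue g"
  shows "fourier (\<lambda>x. f x + g x) = (\<lambda>\<xi>. fourier f \<xi> + fourier g \<xi>)"
  unfolding fourier_def distrib_right
  by (rule ext) (rule Bochner_Integration.integral_add; rule integrable_lebesgue_kernel; fact assms)

lemma fourier_cmult: "fourier (\<lambda>x. a * f x) = (\<lambda>\<xi>. a * fourier f \<xi>)"
  by (rule ext) (simp add: fourier_def mult.assoc)

lemma has_fourier_L2_add:
  assumes "has_fourier_L2 u v" "has_fourier_L2 u' v'"
  shows "has_fourier_L2 (\<lambda>x. u x + u' x) (\<lambda>x. v x + v' x)"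
proof -
  obtain f f' where "\<And>k. integrable lebesgue (f k)" "L2_tendsto f u" "L2_tendsto (\<lambda>k. fourier (f k)) v"
    and "\<And>k. integrable lebesgue (f' k)" "L2_tendsto f' u'" "L2_tendsto (\<lambda>k. fourier (f' k)) v'"
    using assms by (auto simp: has_fourier_L2_def)
  then show ?thesis
    unfolding has_fourier_L2_def
    by (intro exI[of _ "\<lambda>k x. f k x + f' k x"]) (simp add: fourier_add L2_tendsto_add)
qed

lemma has_fourier_L2_cmult:
  assumes "has_fourier_L2 u v"
  shows "has_fourier_L2 (\<lambda>x. a * u x) (\<lambda>x. a * v x)"
proof -
  obtain f where "\<And>k. integrable lebesgue (f k)" "L2_tendsto f u" "L2_tendsto (\<lambda>k. fourier (f k)) v"
    using assms by (auto simp: has_fourier_L2_def)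
  then show ?thesis
    unfolding has_fourier_L2_def
    by (intro exI[of _ "\<lambda>k x. a * f k x"]) (simp add: fourier_cmult L2_tendsto_cmult)
qed

lemma has_fourier_L2_diff:
  assumes "has_fourier_L2 u v" "has_fourier_L2 u' v'"
  shows "has_fourier_L2 (\<lambda>x. u x - u' x) (\<lambda>x. v x - v' x)"
  using has_fourier_L2_add[OF assms(1) has_fourier_L2_cmult[OF assms(2), of "-1"]] by simp

lemma has_fourier_L2_fourier:
  assumes "integrable lebesgue f" "f \<in> L2"
  shows "has_fourier_L2 f (fourier f)"
  unfolding has_fourier_L2_def
  by (rule exI[of _ "\<lambda>_. f"]) (use assms fourier_L2_bound[OF assms] in \<open>auto simp: L2_tendsto_iff L2_sq_def\<close>)

lemma has_fourier_L2_zero: "has_fourier_L2 (\<lambda>x. 0) (\<lambda>\<xi>. 0)"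
  using has_fourier_L2_fourier[of "\<lambda>x. 0"] by (simp add: L2_zero fourier_def[abs_def])

lemma has_fourier_L2_sum:
  assumes "\<And>i. i \<in> I \<Longrightarrow> has_fourier_L2 (u i) (v i)"
  shows "has_fourier_L2 (\<lambda>x. \<Sum>i\<in>I. u i x) (\<lambda>\<xi>. \<Sum>i\<in>I. v i \<xi>)"
  using assms by (induction I rule: infinite_finite_induct) (auto intro: has_fourier_L2_add has_fourier_L2_zero)

text \<open>The 4 stems from two squared triangle inequalities, one between \<open>v\<close> and the
  transform of \<open>f k\<close>, the other between \<open>f k\<close> and \<open>u\<close>; the
  error terms vanish in the limit.\<close>

lemma has_fourier_L2_bound:
  fixes u v :: "'a::euclidean_space \<Rightarrow> complex"
  assumes "has_fourier_L2 u v"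
  shows "L2_sq v \<le> 4 * (2 * pi) ^ DIM('a) * L2_sq u"
proof -
  let ?c = "(2 * pi) ^ DIM('a) :: real"
  obtain f where f: "\<And>k. integrable lebesgue (f k)" "L2_tendsto f u" "L2_tendsto (\<lambda>k. fourier (f k)) v"
    using assms by (auto simp: has_fourier_L2_def)
  have L2: "\<And>k. f k \<in> L2" "u \<in> L2" "v \<in> L2" "\<And>k. fourier (f k) \<in> L2"
    using f by (auto simp: L2_tendsto_iff)
  have "(\<lambda>k. 2 * L2_sq (\<lambda>x. fourier (f k) x - v x) + 2 * ?c * (2 * L2_sq (\<lambda>x. f k x - u x) + 2 * L2_sq u))
      \<longlonglongrightarrow> 2 * 0 + 2 * ?c * (2 * 0 + 2 * L2_sq u)"
    using f by (intro tendsto_intros) (auto simp: L2_tendsto_iff)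
  moreover have "L2_sq v \<le> 2 * L2_sq (\<lambda>x. fourier (f k) x - v x) + 2 * ?c * (2 * L2_sq (\<lambda>x. f k x - u x) + 2 * L2_sq u)" for k
  proof -
    have "L2_sq v \<le> 2 * L2_sq (\<lambda>x. fourier (f k) x - v x) + 2 * L2_sq (fourier (f k))"
      using L2_sq_add_le[OF L2_diff[OF L2(3) L2(4)[of k]] L2(4)[of k]] L2_sq_minus_commute[of "fourier (f k)" v] by simp
    moreover have "L2_sq (fourier (f k)) \<le> ?c * L2_sq (f k)"
      using fourier_L2_bound(2)[OF f(1) L2(1)] .
    moreover have "?c * L2_sq (f k) \<le> ?c * (2 * L2_sq (\<lambda>x. f k x - u x) + 2 * L2_sq u)"
      using L2_sq_add_le[OF L2_diff[OF L2(1)[of k] L2(2)] L2(2)] by (intro mult_left_mono) auto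
    ultimately show ?thesis by linarith
  qed
  ultimately have "L2_sq v \<le> 2 * 0 + 2 * ?c * (2 * 0 + 2 * L2_sq u)"
    by (intro LIMSEQ_le_const) auto
  then show ?thesis by simp
qed

text \<open>By linearity the difference is a transform of 0, and the bound forces it to vanish. This
  makes the choice in \<open>fourier_L2\<close> harmless.\<close>

lemma has_fourier_L2_AE_unique:
  assumes "has_fourier_L2 u v" "has_fourier_L2 u v'"
  shows "AE \<xi> in lebesgue. v \<xi> = v' \<xi>"
proof -
  have d: "has_fourier_L2 (\<lambda>x. 0) (\<lambda>\<xi>. v \<xi> - v' \<xi>)"
    using has_fourier_L2_diff[OF assms] by simp
  have "L2_sq (\<lambda>\<xi>. v \<xi> - v' \<xi>) \<le> 0"
    using has_fourier_L2_bound[OF d] by (simp add: L2_sq_def)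
  from L2_sq_le_0_imp_AE_zero[OF has_fourier_L2_D(2)[OF d] this] show ?thesis by simp
qed

lemma has_fourier_L2_AE_cong:
  assumes "has_fourier_L2 u v" "AE \<xi> in lebesgue. v \<xi> = v' \<xi>"
  shows "has_fourier_L2 u v'"
  using assms L2_tendsto_AE_cong[OF _ assms(2)] by (auto simp: has_fourier_L2_def)

text \<open>A diagonal argument on pairs: for each \<open>k\<close> one integrable function is
  picked that is close to \<open>a k\<close> while its transform is close to
  \<open>b k\<close>.\<close>

lemma has_fourier_L2_closed:
  assumes "\<And>k. has_fourier_L2 (a k) (b k)" "L2_tendsto a u" "L2_tendsto b v"
  shows "has_fourier_L2 u v"
proof -
  have "\<exists>f. integrable lebesgue f \<and> f \<in> L2 \<and> fourier f \<in> L2 \<and>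
      L2_sq (\<lambda>x. f x - a k x) < inverse (Suc k) \<and> L2_sq (\<lambda>x. fourier f x - b k x) < inverse (Suc k)" for k
  proof -
    obtain f where f: "\<And>j. integrable lebesgue (f j)" "L2_tendsto f (a k)" "L2_tendsto (\<lambda>j. fourier (f j)) (b k)"
      using assms(1)[of k] by (auto simp: has_fourier_L2_def)
    have "inverse (real (Suc k)) > 0" by simp
    from L2_tendstoD[OF f(2) this] obtain J where J: "\<And>j. j \<ge> J \<Longrightarrow> L2_sq (\<lambda>x. f j x - a k x) < inverse (Suc k)"
      by blast
    from L2_tendstoD[OF f(3) \<open>inverse (real (Suc k)) > 0\<close>]
    obtain J' where J': "\<And>j. j \<ge> J' \<Longrightarrow> L2_sq (\<lambda>x. fourier (f j) x - b k x) < inverse (Suc k)"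
      by blast
    show ?thesis
      \<comment> \<open>A common index is required, since the function and its transform must be
        close simultaneously.\<close>
      using f J[of "max J J'"] J'[of "max J J'"] by (intro exI[of _ "f (max J J')"]) (auto simp: L2_tendsto_iff)
  qed
  then obtain f where f: "\<And>k. integrable lebesgue (f k)" "\<And>k. f k \<in> L2" "\<And>k. fourier (f k) \<in> L2"
      "\<And>k. L2_sq (\<lambda>x. f k x - a k x) < inverse (Suc k)"
      "\<And>k. L2_sq (\<lambda>x. fourier (f k) x - b k x) < inverse (Suc k)"
    by metis
  have close: "L2_tendsto g w" if g: "\<And>k. g k \<in> L2" "\<And>k. L2_sq (\<lambda>x. g k x - h k x) < inverse (Suc k)" and h: "L2_tendsto h w"
    for g h :: "nat \<Rightarrow> 'a \<Rightarrow> complex" and w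
  proof (rule L2_tendstoI_le[OF g(1)])
    note h' = h[unfolded L2_tendsto_iff]
    show "w \<in> L2" using h' by simp
    show "L2_sq (\<lambda>x. g k x - w x) \<le> 2 * inverse (Suc k) + 2 * L2_sq (\<lambda>x. h k x - w x)" for k
      using L2_sq_triangle[of "g k" "h k" w] g(1)[of k] g(2)[of k] h' by fastforce
    have "(\<lambda>k. 2 * inverse (real (Suc k)) + 2 * L2_sq (\<lambda>x. h k x - w x)) \<longlonglongrightarrow> 2 * 0 + 2 * 0"
      using h' by (intro tendsto_intros LIMSEQ_inverse_real_of_nat) auto
    then show "(\<lambda>k. 2 * inverse (real (Suc k)) + 2 * L2_sq (\<lambda>x. h k x - w x)) \<longlonglongrightarrow> 0" by simp
  qed
  show ?thesis
    unfolding has_fourier_L2_def using f close[OF f(2,4) assms(2)] close[OF f(3,5) assms(3)] by blast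
qed

lemma has_fourier_L2_Cc:
  assumes "f \<in> Cc" shows "has_fourier_L2 f (fourier f)"
  using Cc_integrable[OF assms] Cc_L2[OF assms] Cc_measurable[OF assms]
  by (intro has_fourier_L2_fourier) (auto simp: integrable_completion)

lemma has_fourier_L2_Cauchy:
  assumes "\<And>k. has_fourier_L2 (f k) (g k)" "L2_Cauchy f"
  shows "L2_Cauchy g"
  by (rule L2_Cauchy_scaled[OF assms(2) has_fourier_L2_D(2)[OF assms(1)] _
      has_fourier_L2_bound[OF has_fourier_L2_diff[OF assms(1) assms(1)]]]) simp

text \<open>The bound makes the transforms of a compactly supported approximation Cauchy,
  completeness supplies their limit, and closedness of the relation identifies it as a
  transform.\<close>

theorem has_fourier_L2_exists:
  assumes "u \<in> L2" shows "\<exists>v. has_fourier_L2 u v"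
proof -
  obtain f where f: "\<And>k. f k \<in> Cc" "L2_tendsto f u" using Cc_dense[OF assms] by blast
  note F = has_fourier_L2_Cc[OF f(1)]
  obtain v where "L2_tendsto (\<lambda>k. fourier (f k)) v"
    using L2_complete[OF has_fourier_L2_Cauchy[OF F L2_tendsto_imp_Cauchy[OF f(2)]]] by blast
  from has_fourier_L2_closed[OF F f(2) this] show ?thesis by blast
qed

text \<open>The transform of \<open>f\<close> may fail to be integrable, so its conjugate is
  approached in L2 by damped versions. Their transforms are Gaussian averages of the conjugate of
  \<open>f\<close> and converge pointwise; they are also Cauchy in L2, so the pointwise limit is the
  L2 limit.\<close>

lemma has_fourier_L2_cnj_Cc:
  fixes f :: "'a::euclidean_space \<Rightarrow> complex"
  assumes f: "f \<in> Cc"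
  shows "has_fourier_L2 (\<lambda>\<xi>. cnj (fourier f \<xi>)) (\<lambda>x. (2 * pi) ^ DIM('a) * cnj (f x))"
proof -
  have fi: "integrable lborel f" using Cc_integrable[OF f] .
  have fm [measurable]: "f \<in> borel_measurable borel" using Cc_measurable[OF f] .
  note [measurable] = fourier_measurable[OF fm]
  have w: "(\<lambda>\<xi>. cnj (fourier f \<xi>)) \<in> L2"
    by (rule L2_cnj) (rule has_fourier_L2_D(2)[OF has_fourier_L2_Cc[OF f]])
  define e where "e k = inverse (real (Suc k))" for k
  have e: "e k > 0" for k by (simp add: e_def)
  define g where "g k \<xi> = cnj (fourier f \<xi>) * gauss_damp (e k) \<xi>" for k \<xi>
  have gm: "g k \<in> borel_measurable borel" for k unfolding g_def by measurable
  have gi: "integrable lebesgue (g k)" for k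
  proof -
    have "integrable lborel (g k)"
      unfolding g_def by (rule integrable_fourier_damp[OF fi e])
    then show ?thesis using gm[of k] by (simp add: integrable_completion)
  qed
  have lim: "L2_tendsto g (\<lambda>\<xi>. cnj (fourier f \<xi>))"
  proof (rule L2_tendsto_dominated[OF _ w])
    show "g k \<in> borel_measurable lebesgue" for k
      using gi[of k] by auto
    have "(\<lambda>k. g k \<xi>) \<longlonglongrightarrow> cnj (fourier f \<xi>) * 1" for \<xi>
      unfolding g_def e_def by (intro tendsto_intros gauss_damp_tendsto)
    then show "AE \<xi> in lebesgue. (\<lambda>k. g k \<xi>) \<longlonglongrightarrow> cnj (fourier f \<xi>)" by simp
    show "AE \<xi> in lebesgue. cmod (g k \<xi>) \<le> cmod (cnj (fourier f \<xi>))" for k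
      by (intro AE_I2) (simp add: g_def norm_mult mult_left_le cmod_gauss_damp_le)
  qed
  then have "g k \<in> L2" for k by (simp add: L2_tendsto_iff)
  note F = has_fourier_L2_fourier[OF gi this]
  have cf: "(\<lambda>x. cnj (f x)) \<in> Cc"
    using f by (auto simp: Cc_def intro!: continuous_intros)
  have "fourier (g k) x = (2 * pi) ^ DIM('a) * conv (\<lambda>y. cnj (f y)) (\<lambda>y. complex_of_real (gaussian (e k) y)) x" for k x
    unfolding g_def by (rule fourier_regularized[OF fi e])
  then have "(\<lambda>k. fourier (g k) x) \<longlonglongrightarrow> (2 * pi) ^ DIM('a) * cnj (f x)" for x
    unfolding e_def by (simp only:) (intro tendsto_mult tendsto_const conv_gaussian_tendsto[OF cf])
  then have "L2_tendsto (\<lambda>k. fourier (g k)) (\<lambda>x. (2 * pi) ^ DIM('a) * cnj (f x))"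
    by (intro L2_Cauchy_pointwise_limit has_fourier_L2_Cauchy[OF F L2_tendsto_imp_Cauchy[OF lim]]) simp
  from has_fourier_L2_closed[OF F lim this] show ?thesis .
qed

text \<open>The relation only promises integrable approximants. A sequence from \<open>Cc\<close>
  has transforms with some L2 limit, and uniqueness shows that this limit is \<open>v\<close> almost
  everywhere.\<close>

lemma has_fourier_L2_Cc_approx:
  assumes "has_fourier_L2 u v"
  obtains f where "\<And>k. f k \<in> Cc" "L2_tendsto f u" "L2_tendsto (\<lambda>k. fourier (f k)) v"
proof -
  obtain f where f: "\<And>k. f k \<in> Cc" "L2_tendsto f u"
    using Cc_dense[OF has_fourier_L2_D(1)[OF assms]] by blast
  note F = has_fourier_L2_Cc[OF f(1)]
  obtain v' where v': "L2_tendsto (\<lambda>k. fourier (f k)) v'"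
    using L2_complete[OF has_fourier_L2_Cauchy[OF F L2_tendsto_imp_Cauchy[OF f(2)]]] by blast
  have "AE \<xi> in lebesgue. v' \<xi> = v \<xi>"
    by (rule has_fourier_L2_AE_unique[OF has_fourier_L2_closed[OF F f(2) v'] assms])
  from that[OF f L2_tendsto_AE_cong[OF v' this]] show ?thesis .
qed

text \<open>Fourier inversion. Conjugation replaces the reflection: the inverse transform of \<open>w\<close> is the
  conjugate of the transform of the conjugate of \<open>w\<close>, up to the factor \<open>(2 \<pi>)\<^sup>n\<close>.\<close>

theorem has_fourier_L2_inversion:
  fixes u v :: "'a::euclidean_space \<Rightarrow> complex"
  assumes "has_fourier_L2 u v"
  shows "has_fourier_L2 (\<lambda>\<xi>. cnj (v \<xi>)) (\<lambda>x. (2 * pi) ^ DIM('a) * cnj (u x))"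
proof -
  obtain f where f: "\<And>k. f k \<in> Cc" "L2_tendsto f u" "L2_tendsto (\<lambda>k. fourier (f k)) v"
    using has_fourier_L2_Cc_approx[OF assms] by blast
  show ?thesis
    by (rule has_fourier_L2_closed[OF has_fourier_L2_cnj_Cc[OF f(1)] L2_tendsto_cnj[OF f(3)]
          L2_tendsto_cmult[OF L2_tendsto_cnj[OF f(2)]]])
qed

text \<open>If \<open>w\<close> is a transform of the conjugate of \<open>v\<close>, inversion makes
  the conjugate of \<open>w\<close> a preimage of \<open>(2 * pi) ^ DIM('a)\<close> times
  \<open>v\<close>.\<close>

theorem has_fourier_L2_surj:
  fixes v :: "'a::euclidean_space \<Rightarrow> complex"
  assumes "v \<in> L2" shows "\<exists>u. has_fourier_L2 u v"
proof -
  obtain w where "has_fourier_L2 (\<lambda>\<xi>. cnj (v \<xi>)) w"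
    using has_fourier_L2_exists[OF L2_cnj[OF assms]] by blast
  from has_fourier_L2_cmult[OF has_fourier_L2_inversion[OF this], of "1 / (2 * pi) ^ DIM('a)"]
  show ?thesis by auto
qed

text \<open>The forward bound is applied to the inverted pair. Its left side carries the square of
  \<open>(2 * pi) ^ DIM('a)\<close> and its right side the first power, so one power
  cancels.\<close>

lemma has_fourier_L2_inverse_bound:
  fixes u v :: "'a::euclidean_space \<Rightarrow> complex"
  assumes "has_fourier_L2 u v"
  shows "L2_sq u \<le> 4 / (2 * pi) ^ DIM('a) * L2_sq v"
proof -
  let ?c = "(2 * pi) ^ DIM('a) :: real"
  have "cmod (complex_of_real ?c) = ?c" by (subst norm_of_real) simp
  then have "?c\<^sup>2 * L2_sq u \<le> 4 * ?c * L2_sq v"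
    using has_fourier_L2_bound[OF has_fourier_L2_inversion[OF assms]]
    unfolding L2_sq_cmult L2_sq_cnj by (simp only:)
  then have "?c * (?c * L2_sq u) \<le> ?c * (4 * L2_sq v)"
    by (simp only: power2_eq_square mult_ac)
  moreover have "?c > 0" by simp
  ultimately have "?c * L2_sq u \<le> 4 * L2_sq v"
    by (simp only: mult_le_cancel_left_pos)
  then show ?thesis using \<open>?c > 0\<close> by (simp only: times_divide_eq_left pos_le_divide_eq mult.commute[of "L2_sq u"])
qed

lemma has_fourier_L2_inverse_Cauchy:
  assumes "\<And>k. has_fourier_L2 (f k) (g k)" "L2_Cauchy g"
  shows "L2_Cauchy f"
  by (rule L2_Cauchy_scaled[OF assms(2) has_fourier_L2_D(1)[OF assms(1)] _
      has_fourier_L2_inverse_bound[OF has_fourier_L2_diff[OF assms(1) assms(1)]]]) simp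

lemma has_fourier_L2_fourier_L2:
  assumes "u \<in> L2" shows "has_fourier_L2 u (fourier_L2 u)"
  unfolding fourier_L2_def using has_fourier_L2_exists[OF assms] by (rule someI_ex)

lemma has_fourier_L2_inv_fourier_L2:
  assumes "v \<in> L2" shows "has_fourier_L2 (inv_fourier_L2 v) v"
  unfolding inv_fourier_L2_def using has_fourier_L2_surj[OF assms] by (rule someI_ex)

section \<open>Convolution of an L2 function with a bounded integrable filter\<close>

lemma integrable_lborel_reflect:
  fixes f :: "'a::euclidean_space \<Rightarrow> complex"
  assumes "integrable lborel f"
  shows "integrable lborel (\<lambda>y. f (x - y))"
proof -
  have [measurable]: "f \<in> borel_measurable borel" using borel_measurable_integrable[OF assms] by simp
  have "lborel = distr lborel borel (\<lambda>y::'a. x - y)"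
    using lborel_affine[of "-1" x] by (simp add: density_1)
  then have "integrable (distr lborel borel (\<lambda>y::'a. x - y)) f" using assms by simp
  then show ?thesis by (subst (asm) integrable_distr_eq) auto
qed

lemma integrable_lebesgue_if_lborel: "integrable lborel f \<Longrightarrow> integrable lebesgue f"
  for f :: "'a::euclidean_space \<Rightarrow> complex"
  using borel_measurable_integrable by (auto simp: integrable_completion)

text \<open>For compactly supported continuous \<open>u\<close> this is the classical convolution theorem. In general the
  approximations converge in \<open>L2\<close> because their transforms do, and pointwise because \<open>\<Phi>\<close> is in \<open>L2\<close>.\<close>

lemma has_fourier_L2_conv:
  fixes u v \<Phi> :: "'a::euclidean_space \<Rightarrow> complex"
  assumes uv: "has_fourier_L2 u v" and \<Phi>: "integrable lborel \<Phi>" and B: "\<And>x. cmod (\<Phi> x) \<le> B"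
  shows "has_fourier_L2 (conv u \<Phi>) (\<lambda>\<xi>. fourier \<Phi> \<xi> * v \<xi>)"
proof -
  have \<Phi>m [measurable]: "\<Phi> \<in> borel_measurable borel" using borel_measurable_integrable[OF \<Phi>] by simp
  obtain f where f: "\<And>k. f k \<in> Cc" "L2_tendsto f u" "L2_tendsto (\<lambda>k. fourier (f k)) v"
    using has_fourier_L2_Cc_approx[OF uv] by blast
  note fi = Cc_integrable[OF f(1)] and [measurable] = Cc_measurable[OF f(1)]
  have ci: "integrable lebesgue (conv (f k) \<Phi>)" for k
    by (intro integrable_lebesgue_if_lborel integrable_conv fi \<Phi>)
  \<comment> \<open>The convolution is bounded by \<open>B\<close> times the integral of
    \<open>cmod (f k y)\<close>; a bounded integrable function is square-integrable.\<close>
  have "conv (f k) \<Phi> \<in> L2" for k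
  proof (rule L2_of_bounded_integrable[OF ci])
    fix x
    have "cmod (conv (f k) \<Phi> x) \<le> (LINT y|lborel. cmod (f k y * \<Phi> (x - y)))"
      by (subst conv_lborel) auto
    also have "\<dots> \<le> (LINT y|lborel. cmod (f k y) * B)"
    proof (rule integral_mono)
      show "integrable lborel (\<lambda>y. cmod (f k y * \<Phi> (x - y)))"
        using integrable_lborel_bounded_mult[OF fi, of "\<lambda>y. \<Phi> (x - y)" B] B
        by (simp add: mult.commute)
    qed (use fi B in \<open>auto simp: norm_mult intro!: mult_left_mono\<close>)
    finally show "cmod (conv (f k) \<Phi> x) \<le> (LINT y|lborel. cmod (f k y) * B)" .
  qed
  from has_fourier_L2_fourier[OF ci this]
  have F: "has_fourier_L2 (conv (f k) \<Phi>) (\<lambda>\<xi>. fourier \<Phi> \<xi> * fourier (f k) \<xi>)" for k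
    unfolding fourier_conv[OF fi \<Phi>, abs_def] by (simp only: mult.commute)
  have lim: "L2_tendsto (\<lambda>k \<xi>. fourier \<Phi> \<xi> * fourier (f k) \<xi>) (\<lambda>\<xi>. fourier \<Phi> \<xi> * v \<xi>)"
  proof (rule L2_tendsto_bounded_mult[OF f(3)])
    show "fourier \<Phi> \<in> borel_measurable lebesgue"
      using fourier_measurable[OF \<Phi>m] by (intro measurable_completion) simp
  qed (rule cmod_fourier_le)
  have "(\<lambda>k. conv (f k) \<Phi> x) \<longlonglongrightarrow> conv u \<Phi> x" for x
    unfolding conv_def
  proof (rule L2_tendsto_integral_mult[OF f(2)])
    show "(\<lambda>y. \<Phi> (x - y)) \<in> L2"
      by (rule L2_of_bounded_integrable[OF integrable_lebesgue_if_lborel[OF integrable_lborel_reflect[OF \<Phi>]] B])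
  qed
  then have "L2_tendsto (\<lambda>k. conv (f k) \<Phi>) (conv u \<Phi>)"
    by (intro L2_Cauchy_pointwise_limit has_fourier_L2_inverse_Cauchy[OF F L2_tendsto_imp_Cauchy[OF lim]]) simp
  from has_fourier_L2_closed[OF F this lim] show ?thesis .
qed

subsection \<open>Difference-of-Gaussians filters\<close>

lemma
  fixes r \<sigma>0 :: real
  assumes "r > 1" "\<sigma>0 > 0"
  shows dog_filter_integrable: "integrable lborel (dog_filter r \<sigma>0 s :: 'a::euclidean_space \<Rightarrow> complex)"
    and dog_filter_bounded: "cmod (dog_filter r \<sigma>0 s (x :: 'a)) \<le> gaussian (dog_scale r \<sigma>0 s) (0::'a) + gaussian (dog_scale r \<sigma>0 (s - 1)) (0::'a)"
    and fourier_dog_filter: "fourier (dog_filter r \<sigma>0 s) = (\<lambda>\<xi>::'a. gauss_damp (dog_scale r \<sigma>0 s) \<xi> - gauss_damp (dog_scale r \<sigma>0 (s - 1)) \<xi>)"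
proof -
  have pos: "dog_scale r \<sigma>0 s > 0" for s using assms by (simp add: dog_scale_def)
  have i: "integrable lborel (\<lambda>x::'a. complex_of_real (gaussian (dog_scale r \<sigma>0 s) x))" for s
    using integrable_gaussian[OF pos] by (rule integrable_of_real)
  have eq: "dog_filter r \<sigma>0 s = (\<lambda>x::'a. complex_of_real (gaussian (dog_scale r \<sigma>0 s) x) +
      (-1) * complex_of_real (gaussian (dog_scale r \<sigma>0 (s - 1)) x))"
    by (rule ext) (simp add: dog_filter_def)
  show "integrable lborel (dog_filter r \<sigma>0 s :: 'a \<Rightarrow> complex)"
    unfolding eq by (intro Bochner_Integration.integrable_add integrable_mult_right i)
  show "cmod (dog_filter r \<sigma>0 s (x :: 'a)) \<le> gaussian (dog_scale r \<sigma>0 s) (0::'a) + gaussian (dog_scale r \<sigma>0 (s - 1)) (0::'a)"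
    unfolding dog_filter_def norm_of_real
    using gaussian_le[of "dog_scale r \<sigma>0 s" x] gaussian_le[of "dog_scale r \<sigma>0 (s - 1)" x]
      gaussian_nonneg[of "dog_scale r \<sigma>0 s" x] gaussian_nonneg[of "dog_scale r \<sigma>0 (s - 1)" x] by linarith
  show "fourier (dog_filter r \<sigma>0 s) = (\<lambda>\<xi>::'a. gauss_damp (dog_scale r \<sigma>0 s) \<xi> - gauss_damp (dog_scale r \<sigma>0 (s - 1)) \<xi>)"
    unfolding eq
    by (subst fourier_add) (simp_all add: integrable_lebesgue_if_lborel[OF i] fourier_gaussian[OF pos] fourier_cmult
        del: minus_mult_left mult_minus1 add: fourier_cmult[of "-1", simplified])
qed

text \<open>The sum of absolute values is a crude radius that also covers the empty set, where a
  maximum would be undefined.\<close>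

lemma subset_symmetric_interval:
  fixes F :: "int set"
  assumes "finite F" "(\<Sum>s\<in>F. nat \<bar>s\<bar>) \<le> N"
  shows "F \<subseteq> {- int N..int N}"
proof
  fix s assume "s \<in> F"
  then have "nat \<bar>s\<bar> \<le> (\<Sum>s\<in>F. nat \<bar>s\<bar>)" using assms(1) by (intro member_le_sum) auto
  then show "s \<in> {- int N..int N}" using assms(2) by auto
qed

text \<open>\<open>filter_energy\<close> is a limit along all finite index sets, whereas the theorem
  concerns symmetric partial sums; this passes from the former to the latter.\<close>

lemma filterlim_symmetric_intervals:
  "filterlim (\<lambda>N. {- int N..int N}) (finite_subsets_at_top UNIV) sequentially"
  unfolding filterlim_finite_subsets_at_top
proof (intro allI impI)
  fix F :: "int set" assume F: "finite F \<and> F \<subseteq> UNIV"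
  show "\<forall>\<^sub>F N in sequentially. finite {- int N..int N} \<and> F \<subseteq> {- int N..int N} \<and> {- int N..int N} \<subseteq> UNIV"
  proof (rule eventually_sequentiallyI)
    fix N assume N: "(\<Sum>s\<in>F. nat \<bar>s\<bar>) \<le> N"
    with F have "F \<subseteq> {- int N..int N}" by (intro subset_symmetric_interval) auto
    then show "finite {- int N..int N} \<and> F \<subseteq> {- int N..int N} \<and> {- int N..int N} \<subseteq> UNIV" by auto
  qed
qed

section \<open>Energies of the filters, their ratios and the reconstruction\<close>

context
  fixes r \<sigma>0 :: real
  assumes r: "r > 1" and \<sigma>0: "\<sigma>0 > 0"
begin

definition dog_energy :: "int \<Rightarrow> 'a::euclidean_space \<Rightarrow> real" where
  "dog_energy s \<xi> = (cmod (fourier (dog_filter r \<sigma>0 s) \<xi>))\<^sup>2"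

text \<open>The real-valued transform of the Gaussian at scale \<open>s\<close>, so that
  monotonicity in \<open>s\<close> can be expressed.\<close>

definition damp :: "int \<Rightarrow> 'a::euclidean_space \<Rightarrow> real" where
  "damp s \<xi> = exp (- ((dog_scale r \<sigma>0 s)\<^sup>2 * (norm \<xi>)\<^sup>2) / 2)"

lemma damp_le_1: "damp s \<xi> \<le> 1" and damp_pos: "0 < damp s \<xi>"
  by (simp_all add: damp_def)

lemma dog_scale_less: "dog_scale r \<sigma>0 (s - 1) < dog_scale r \<sigma>0 s" "0 < dog_scale r \<sigma>0 s"
  using r \<sigma>0 by (auto simp: dog_scale_def power_int_strict_increasing)

lemma damp_less: "\<xi> \<noteq> 0 \<Longrightarrow> damp s \<xi> < damp (s - 1) \<xi>"
  using dog_scale_less[of s] dog_scale_less(2)[of "s - 1"]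
  by (simp add: damp_def power_strict_mono)

lemma damp_le: "damp s \<xi> \<le> damp (s - 1) \<xi>"
  using damp_less[of \<xi> s] by (cases "\<xi> = 0") (auto simp: damp_def)

lemma dog_energy_eq: "dog_energy s \<xi> = (damp (s - 1) \<xi> - damp s \<xi>)\<^sup>2"
proof -
  have "fourier (dog_filter r \<sigma>0 s) \<xi> = complex_of_real (damp s \<xi> - damp (s - 1) \<xi>)"
    unfolding fourier_dog_filter[OF r \<sigma>0] gauss_damp_def damp_def by simp
  then show ?thesis
    unfolding dog_energy_def by (simp only: norm_of_real power2_abs power2_commute)
qed

text \<open>The difference of neighbouring values lies between 0 and 1, so squaring does not
  increase it. The energies are thereby dominated by a telescoping sum.\<close>

lemma dog_energy_le: "dog_energy s \<xi> \<le> damp (s - 1) \<xi> - damp s \<xi>"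
proof -
  have "damp (s - 1) \<xi> - damp s \<xi> \<le> 1" using damp_le_1[of "s - 1" \<xi>] damp_pos[of s \<xi>] by linarith
  then show ?thesis
    unfolding dog_energy_eq power2_eq_square using damp_le[of s \<xi>] by (intro mult_left_le) auto
qed

lemma sum_damp_telescope:
  "(\<Sum>s\<in>{- int N..int N}. damp (s - 1) \<xi> - damp s \<xi>) = damp (- int N - 1) \<xi> - damp (int N) \<xi>"
proof (induction N)
  case (Suc N)
  \<comment> \<open>The interval grows at both ends, and the two new differences cancel the former
    boundary terms.\<close>
  have "{- int (Suc N)..int (Suc N)} = insert (- int (Suc N)) (insert (int (Suc N)) {- int N..int N})"
    by auto
  then show ?case
    using Suc by (simp add: algebra_simps) (auto intro!: arg_cong[where f = "\<lambda>s. damp s \<xi>"])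
qed simp

lemma dog_energy_nonneg: "0 \<le> dog_energy s \<xi>"
  by (simp add: dog_energy_def)

text \<open>Every finite sum is at most a telescoping sum over a symmetric interval, which is a
  difference of two numbers in (0, 1].\<close>

lemma dog_energy_summable: "(\<lambda>s. dog_energy s \<xi>) summable_on UNIV"
proof (rule nonneg_bdd_above_summable_on)
  have "(\<Sum>s\<in>F. dog_energy s \<xi>) \<le> 1" if F: "finite F" for F
  proof -
    obtain N where N: "F \<subseteq> {- int N..int N}"
      using subset_symmetric_interval[OF F order_refl] by blast
    have "(\<Sum>s\<in>F. dog_energy s \<xi>) \<le> (\<Sum>s\<in>{- int N..int N}. dog_energy s \<xi>)"
      using N by (intro sum_mono2) (auto simp: dog_energy_nonneg)
    also have "\<dots> \<le> (\<Sum>s\<in>{- int N..int N}. damp (s - 1) \<xi> - damp s \<xi>)"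
      by (intro sum_mono dog_energy_le)
    also have "\<dots> \<le> 1"
      unfolding sum_damp_telescope using damp_le_1[of "- int N - 1" \<xi>] damp_pos[of "int N" \<xi>] by linarith
    finally show ?thesis .
  qed
  then show "bdd_above (sum (\<lambda>s. dog_energy s \<xi>) ` {F. F \<subseteq> UNIV \<and> finite F})"
    by (auto intro!: bdd_aboveI[of _ 1])
qed (rule dog_energy_nonneg)

lemma filter_energy_eq: "filter_energy r \<sigma>0 \<xi> = (\<Sum>\<^sub>\<infinity>s. dog_energy s \<xi>)"
  by (simp add: filter_energy_def dog_energy_def)

lemma partial_energy_tendsto: "(\<lambda>N. \<Sum>s\<in>{- int N..int N}. dog_energy s \<xi>) \<longlonglongrightarrow> filter_energy r \<sigma>0 \<xi>"
  using has_sum_infsum[OF dog_energy_summable[of \<xi>]]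
  unfolding has_sum_def filter_energy_eq by (rule filterlim_compose[OF _ filterlim_symmetric_intervals])

lemma partial_energy_le:
  assumes "finite F" shows "(\<Sum>s\<in>F. dog_energy s \<xi>) \<le> filter_energy r \<sigma>0 \<xi>"
  unfolding filter_energy_eq
  by (rule finite_sum_le_infsum[OF dog_energy_summable assms]) (auto simp: dog_energy_nonneg)

text \<open>The single term \<open>s = 0\<close> is positive off the origin, since Gaussians of
  different scales have different transforms there.\<close>

lemma filter_energy_pos:
  assumes "\<xi> \<noteq> 0" shows "filter_energy r \<sigma>0 \<xi> > 0"
proof -
  have "0 < dog_energy 0 \<xi>" unfolding dog_energy_eq using damp_less[OF assms, of 0] by simp
  then show ?thesis using partial_energy_le[of "{0}" \<xi>] by simp
qed

lemma dog_energy_measurable: "dog_energy s \<in> borel_measurable borel"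
  unfolding dog_energy_eq[abs_def] damp_def by measurable

lemma filter_energy_measurable: "filter_energy r \<sigma>0 \<in> borel_measurable borel"
  by (rule borel_measurable_LIMSEQ_real[OF partial_energy_tendsto])
    (intro borel_measurable_sum dog_energy_measurable)

text \<open>The Fourier multiplier of one summand of the reconstruction, that is, filtering with
  \<open>\<Phi>\<close> at scale \<open>s\<close> followed by its dual filter.\<close>

definition energy_ratio :: "int \<Rightarrow> 'a::euclidean_space \<Rightarrow> complex" where
  "energy_ratio s \<xi> = complex_of_real (dog_energy s \<xi> / filter_energy r \<sigma>0 \<xi>)"

lemma dual_symbol_mult: "dual_symbol r \<sigma>0 s \<xi> * fourier (dog_filter r \<sigma>0 s) \<xi> = energy_ratio s \<xi>"
  unfolding dual_symbol_def energy_ratio_def dog_energy_def of_real_divide complex_norm_square by (simp add: mult.commute)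

lemma cmod_sum_energy_ratio_le:
  assumes "finite F" shows "cmod (\<Sum>s\<in>F. energy_ratio s \<xi>) \<le> 1"
proof -
  have "(\<Sum>s\<in>F. energy_ratio s \<xi>) = complex_of_real ((\<Sum>s\<in>F. dog_energy s \<xi>) / filter_energy r \<sigma>0 \<xi>)"
    by (simp add: energy_ratio_def sum_divide_distrib)
  moreover have "\<bar>(\<Sum>s\<in>F. dog_energy s \<xi>) / filter_energy r \<sigma>0 \<xi>\<bar> \<le> 1"
  proof -
    have "0 \<le> (\<Sum>s\<in>F. dog_energy s \<xi>)" by (intro sum_nonneg dog_energy_nonneg)
    \<comment> \<open>At the origin all energies vanish and the quotient is 0 / 0 = 0, which
      respects the bound.\<close>
    then show ?thesis
      using partial_energy_le[OF assms, of \<xi>] by (cases "filter_energy r \<sigma>0 \<xi> = 0") (auto simp: divide_le_eq_1)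
  qed
  ultimately show ?thesis by (simp only: norm_of_real)
qed

lemma energy_ratio_measurable: "energy_ratio s \<in> borel_measurable borel"
  using dog_energy_measurable filter_energy_measurable unfolding energy_ratio_def by measurable

lemma sum_energy_ratio_tendsto:
  assumes "\<xi> \<noteq> 0" shows "(\<lambda>N. \<Sum>s\<in>{- int N..int N}. energy_ratio s \<xi>) \<longlonglongrightarrow> 1"
proof -
  have "(\<lambda>N. complex_of_real ((\<Sum>s\<in>{- int N..int N}. dog_energy s \<xi>) / filter_energy r \<sigma>0 \<xi>))
      \<longlonglongrightarrow> complex_of_real (filter_energy r \<sigma>0 \<xi> / filter_energy r \<sigma>0 \<xi>)"
    using filter_energy_pos[OF assms] by (intro tendsto_intros partial_energy_tendsto) auto
  then show ?thesis
    using filter_energy_pos[OF assms] by (simp add: energy_ratio_def sum_divide_distrib)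
qed

lemma L2_energy_ratio_mult:
  assumes "v \<in> L2" shows "(\<lambda>\<xi>. energy_ratio s \<xi> * v \<xi>) \<in> L2"
proof (rule L2_bounded[OF assms])
  have "energy_ratio s \<in> borel_measurable lebesgue"
    using energy_ratio_measurable by (intro measurable_completion) simp
  then show "(\<lambda>\<xi>. energy_ratio s \<xi> * v \<xi>) \<in> borel_measurable lebesgue"
    using L2_D(1)[OF assms] by measurable
  show "AE \<xi> in lebesgue. cmod (energy_ratio s \<xi> * v \<xi>) \<le> 1 * cmod (v \<xi>)"
    unfolding norm_mult using cmod_sum_energy_ratio_le[of "{s}"] by (intro AE_I2 mult_right_mono) auto
qed

text \<open>Up to null sets the chosen transform of the convolution is the product of the two
  transforms, so the dual symbol combines with the transform of the filter to
  \<open>energy_ratio\<close>.\<close>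

lemma has_fourier_L2_conv_dual:
  assumes "has_fourier_L2 u v"
  shows "has_fourier_L2 (conv_dual r \<sigma>0 s (conv u (dog_filter r \<sigma>0 s))) (\<lambda>\<xi>. energy_ratio s \<xi> * v \<xi>)"
proof -
  let ?w = "conv u (dog_filter r \<sigma>0 s)"
  let ?v = "\<lambda>\<xi>. dual_symbol r \<sigma>0 s \<xi> * fourier_L2 ?w \<xi>"
  have w: "has_fourier_L2 ?w (\<lambda>\<xi>. fourier (dog_filter r \<sigma>0 s) \<xi> * v \<xi>)"
    by (rule has_fourier_L2_conv[OF assms dog_filter_integrable[OF r \<sigma>0] dog_filter_bounded[OF r \<sigma>0]])
  have "AE \<xi> in lebesgue. fourier_L2 ?w \<xi> = fourier (dog_filter r \<sigma>0 s) \<xi> * v \<xi>"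
    by (rule has_fourier_L2_AE_unique[OF has_fourier_L2_fourier_L2[OF has_fourier_L2_D(1)[OF w]] w])
  then have ae: "AE \<xi> in lebesgue. energy_ratio s \<xi> * v \<xi> = ?v \<xi>"
    by eventually_elim (simp add: dual_symbol_mult flip: mult.assoc)
  \<comment> \<open>\<open>inv_fourier_L2\<close> has its meaning only on \<open>L2\<close>;
    membership is inherited from \<open>energy_ratio s \<xi> * v \<xi>\<close>, whose first factor
    is at most 1 in modulus.\<close>
  then have "?v \<in> L2"
    by (rule L2_AE_cong(1)[OF L2_energy_ratio_mult[OF has_fourier_L2_D(2)[OF assms]]])
  then have "has_fourier_L2 (conv_dual r \<sigma>0 s ?w) ?v"
    unfolding conv_dual_def fourier_multiplier_def by (rule has_fourier_L2_inv_fourier_L2)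
  then show ?thesis
    by (rule has_fourier_L2_AE_cong) (use ae in auto)
qed

theorem dog_reconstruction:
  fixes u :: "'a::euclidean_space \<Rightarrow> complex"
  assumes "u \<in> L2"
  shows "L2_tendsto (\<lambda>N x. \<Sum>s\<in>{- int N..int N}. conv_dual r \<sigma>0 s (conv u (dog_filter r \<sigma>0 s)) x) u"
    (is "L2_tendsto ?S u")
proof -
  obtain v where uv: "has_fourier_L2 u v" using has_fourier_L2_exists[OF assms] by blast
  have v: "v \<in> L2" using has_fourier_L2_D[OF uv] by simp
  let ?V = "\<lambda>N \<xi>. \<Sum>s\<in>{- int N..int N}. energy_ratio s \<xi> * v \<xi>"
  have S: "has_fourier_L2 (?S N) (?V N)" for N
    by (intro has_fourier_L2_sum has_fourier_L2_conv_dual uv)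
  have "L2_tendsto ?V v"
  proof (rule L2_tendsto_dominated[OF _ v])
    show "?V N \<in> borel_measurable lebesgue" for N
      using L2_D(1)[OF has_fourier_L2_D(2)[OF S]] .
    \<comment> \<open>At the origin every ratio is 0, so the sums of ratios tend to 1 only off this
      null set.\<close>
    have "AE \<xi> in lebesgue. \<xi> \<noteq> (0::'a)"
      by (intro AE_completion AE_lborel_singleton)
    then show "AE \<xi> in lebesgue. (\<lambda>N. ?V N \<xi>) \<longlonglongrightarrow> v \<xi>"
    proof eventually_elim
      case (elim \<xi>)
      from tendsto_mult_right[OF sum_energy_ratio_tendsto[OF elim], of "v \<xi>"]
      show ?case by (simp add: sum_distrib_right)
    qed
    show "AE \<xi> in lebesgue. cmod (?V N \<xi>) \<le> cmod (v \<xi>)" for N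
    proof (rule AE_I2)
      fix \<xi>
      show "cmod (?V N \<xi>) \<le> cmod (v \<xi>)"
        unfolding sum_distrib_right[symmetric] norm_mult
        using mult_right_mono[OF cmod_sum_energy_ratio_le norm_ge_zero, of "{- int N..int N}" \<xi> "v \<xi>"] by simp
    qed
  qed
  then have "(\<lambda>N. 4 / (2 * pi) ^ DIM('a) * L2_sq (\<lambda>\<xi>. ?V N \<xi> - v \<xi>)) \<longlonglongrightarrow> 0"
    by (intro tendsto_mult_right_zero) (simp add: L2_tendsto_iff)
  then show ?thesis
    by (rule L2_tendstoI_le[OF has_fourier_L2_D(1)[OF S] assms
          has_fourier_L2_inverse_bound[OF has_fourier_L2_diff[OF S uv]]])
qed

end

theorem proposition5p6:
  fixes r \<sigma>0 :: real and u :: "real ^ 'n \<Rightarrow> complex"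
  assumes "r > 1" and "\<sigma>0 > 0" and "u \<in> L2"
  shows "\<exists>S. L2_tendsto
                (\<lambda>N x. \<Sum>s\<in>{- int N..int N}. conv_dual r \<sigma>0 s (conv u (dog_filter r \<sigma>0 s)) x) S
             \<and> (AE x in lebesgue. u x = S x)"
  \<comment> \<open>\<open>u\<close> itself serves as the limit \<open>S\<close>.\<close>
  using dog_reconstruction[OF assms] by auto

end
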